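(* Let $\mathcal{O}$ be an order in a number field. Then $g_{\mathcal{O}}(r)$ is finite for every integer $r\ge 1$.
   Context: An order in a number field $K$ is a subring (with $1$) $\mathcal{O}$ of the ring of integers $\mathcal{O}_K$ which is a $\mathbb{Z}$-module of rank $[K:\mathbb{Q}]$. For a commutative ring $R$ with unity and a positive integer $r$, let $\Sigma_R(r)$ be the set of all quadratic forms (homogeneous polynomials of degree $2$) in $R[X_1,\dots,X_r]$ that can be written as a sum of finitely many squares of linear forms (homogeneous polynomials of degree $1$) in $R[X_1,\dots,X_r]$. Then $g_R(r)$ is the smallest $n\in\mathbb{N}$ such that every form in $\Sigma_R(r)$ is a sum of $n$ squares of linear forms over $R$ (zero linear forms allowed); $g_R(r)=\infty$ if no such $n$ exists. *)

theory Defs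
  imports
    Complex_Main
    "HOL-Library.Extended_Nat"
    "HOL-Library.Poly_Mapping"
    "HOL-Computational_Algebra.Polynomial"
begin

text \<open>
  Rings and fields are represented by their carriers inside an ambient type, so that a number
  field is a subset of an arbitrary field of characteristic 0 (which may be all of the type).
\<close>

definition unital_subring :: "'a::comm_ring_1 set \<Rightarrow> bool" where
  "unital_subring R \<longleftrightarrow>
     1 \<in> R \<and> (\<forall>x\<in>R. \<forall>y\<in>R. x - y \<in> R) \<and> (\<forall>x\<in>R. \<forall>y\<in>R. x * y \<in> R)"

definition subfield_carrier :: "'a::field set \<Rightarrow> bool" where
  "subfield_carrier K \<longleftrightarrow> unital_subring K \<and> (\<forall>x\<in>K. x \<noteq> 0 \<longrightarrow> inverse x \<in> K)"

global_interpretation rat_space: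
  vector_space "\<lambda>(q::rat) (x::'a::field_char_0). of_rat q * x"
  by unfold_locales (simp_all add: algebra_simps of_rat_add of_rat_mult)

global_interpretation int_module:
  module "\<lambda>(k::int) (x::'a::comm_ring_1). of_int k * x"
  by unfold_locales (simp_all add: algebra_simps)

definition number_field :: "'a::field_char_0 set \<Rightarrow> bool" where
  "number_field K \<longleftrightarrow> subfield_carrier K \<and> (\<exists>B. finite B \<and> rat_space.span B = K)"

definition field_degree :: "'a::field_char_0 set \<Rightarrow> nat" where
  "field_degree K = rat_space.dim K"

definition ring_of_integers :: "'a::field_char_0 set \<Rightarrow> 'a set" where
  "ring_of_integers K = {x \<in> K. algebraic_int x}"

definition int_rank :: "'a::comm_ring_1 set \<Rightarrow> enat" where
  "int_rank M =
     Sup {enat (card B) | B. finite B \<and> B \<subseteq> M \<and> int_module.independent B}"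

definition order_in :: "'a::field_char_0 set \<Rightarrow> 'a set \<Rightarrow> bool" where
  "order_in K R \<longleftrightarrow>
     unital_subring R \<and> R \<subseteq> ring_of_integers K \<and> int_rank R = enat (field_degree K)"

text \<open>
  A polynomial is a finitely supported map from monomials to coefficients; a monomial is a
  finitely supported map from variable indices to exponents.
\<close>

type_synonym 'a mpolynomial = "(nat \<Rightarrow>\<^sub>0 nat) \<Rightarrow>\<^sub>0 'a"

definition monomial_degree :: "(nat \<Rightarrow>\<^sub>0 nat) \<Rightarrow> nat" where
  "monomial_degree m = (\<Sum>i\<in>Poly_Mapping.keys m. Poly_Mapping.lookup m i)"

text \<open>
  \<open>forms R r d\<close> consists of the homogeneous polynomials of degree \<open>d\<close> in \<open>R[X\<^sub>1, \<dots>, X\<^sub>r]\<close>;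
  it contains the zero polynomial for every \<open>d\<close>.
\<close>

definition forms :: "'a::comm_ring_1 set \<Rightarrow> nat \<Rightarrow> nat \<Rightarrow> 'a mpolynomial set" where
  "forms R r d = {p. (\<forall>m. Poly_Mapping.lookup p m \<in> R) \<and>
     (\<forall>m\<in>Poly_Mapping.keys p. Poly_Mapping.keys m \<subseteq> {1..r} \<and> monomial_degree m = d)}"

definition sum_of_squares ::
    "'a::comm_ring_1 set \<Rightarrow> nat \<Rightarrow> nat \<Rightarrow> 'a mpolynomial \<Rightarrow> bool" where
  "sum_of_squares R r n q \<longleftrightarrow>
     (\<exists>l. (\<forall>i<n. l i \<in> forms R r 1) \<and> q = (\<Sum>i<n. (l i)\<^sup>2))"

definition Sigma_forms :: "'a::comm_ring_1 set \<Rightarrow> nat \<Rightarrow> 'a mpolynomial set" where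
  "Sigma_forms R r = {q \<in> forms R r 2. \<exists>n. sum_of_squares R r n q}"

text \<open>The infimum of the empty set in \<^typ>\<open>enat\<close> is \<open>\<infinity>\<close>.\<close>

definition g_invariant :: "'a::comm_ring_1 set \<Rightarrow> nat \<Rightarrow> enat" where
  "g_invariant R r = Inf {enat n | n. \<forall>q\<in>Sigma_forms R r. sum_of_squares R r n q}"

end

theory Submission
  imports Defs "HOL-Computational_Algebra.Primes" "HOL-Library.FuncSet"
begin

text \<open>
  Let \<open>\<theta>\<^sub>1, \<dots>, \<theta>\<^sub>n\<close> generate the additive group of linear forms over \<open>\<O>\<close>. A sum of squares of
  such forms is the image, under substitution of the \<open>\<theta>\<^sub>t\<close>, of a sum of squares of integral linear
  forms in \<open>n\<close> variables, so it suffices to bound the number of squares over \<open>\<int>\<close>.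

  Over \<open>\<int>\<close>, reduction theory provides a finite set \<open>F\<close> of integer vectors such that every sum of
  squares \<open>Q\<close> is, up to a unimodular substitution, a nonnegative real combination of the squares
  \<open>f\<^sup>2\<close> with \<open>f \<in> F\<close>. Split each coefficient into integral and fractional part: the fractional
  parts contribute one of finitely many integral forms, and the integral part \<open>\<Sum>f\<in>F. m f * f\<^sup>2\<close> is a
  sum of \<open>4 |F|\<close> squares by Lagrange. If the number of squares were unbounded, take a sequence of
  witnesses with the same fractional contribution and with increasing \<open>m\<close>: each later
  one is the first one plus at most \<open>4 |F|\<close> squares, a contradiction.

  That \<open>\<O>\<close> is a finitely generated group follows from discreteness. Take a \<open>\<rat>\<close>-basis of its span
  inside \<open>\<O>\<close>. If \<open>x \<in> \<O>\<close> has tiny coordinates, those of \<open>x ^ k\<close> tend to 0; but their denominators are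
  bounded since \<open>x\<close> is integral, so \<open>x ^ k = 0\<close> for large \<open>k\<close> and \<open>x = 0\<close>.
\<close>

section \<open>Lagrange's four-square theorem\<close>

text \<open>Least absolute residues, with the bound doubled to stay inside the integers. They drive
  the descent below and later normalise linear coefficients in reduction theory.\<close>

lemma balanced_remainder:
  fixes m x :: int
  assumes "m > 0"
  obtains k where "\<bar>2 * (x + m * k)\<bar> \<le> m"
proof (cases "2 * (x mod m) \<le> m")
  case True
  have "x + m * (- (x div m)) = x mod m"
    by (simp add: minus_mult_div_eq_mod)
  then show ?thesis
    using that[of "- (x div m)"] True assms by simp
next
  case False
  have "x + m * (- (x div m) - 1) = x mod m - m"
    by (simp add: algebra_simps minus_mult_div_eq_mod)
  moreover have "x mod m < m" "0 \<le> x mod m"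
    using assms by auto
  ultimately show ?thesis
    using that[of "- (x div m) - 1"] False by simp
qed

definition sum4 :: "int \<Rightarrow> bool" where
  "sum4 n \<longleftrightarrow> (\<exists>a b c d. n = a\<^sup>2 + b\<^sup>2 + c\<^sup>2 + d\<^sup>2)"

lemma sum4I: "n = a\<^sup>2 + b\<^sup>2 + c\<^sup>2 + d\<^sup>2 \<Longrightarrow> sum4 n"
  unfolding sum4_def by blast

lemma euler_four_square:
  fixes a b c d :: "'a::comm_ring_1"
  shows "(a\<^sup>2 + b\<^sup>2 + c\<^sup>2 + d\<^sup>2) * (e\<^sup>2 + f\<^sup>2 + g\<^sup>2 + h\<^sup>2) =
    (a*e + b*f + c*g + d*h)\<^sup>2 + (a*f - b*e + c*h - d*g)\<^sup>2 +
    (a*g - c*e + d*f - b*h)\<^sup>2 + (a*h - d*e + b*g - c*f)\<^sup>2"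
  by (simp add: power2_eq_square algebra_simps)

lemma sum4_mult: "sum4 m \<Longrightarrow> sum4 n \<Longrightarrow> sum4 (m * n)"
  unfolding sum4_def using euler_four_square by metis

text \<open>Let the \<open>y\<close> be least absolute residues of the \<open>x\<close> modulo
  \<open>m\<close>. Their squares sum to \<open>m * r\<close> with \<open>r \<le> m\<close>, and
  Euler's identity writes the product of the two sums as four squares, each divisible by
  \<open>m\<^sup>2\<close>. The extreme values \<open>r = 0\<close> and \<open>r = m\<close> would
  force \<open>m dvd p\<close>.\<close>

lemma sum4_descent:
  fixes m p :: int
  assumes p: "prime p" and m: "1 < m" "m < p" and s: "sum4 (m * p)"
  obtains r where "0 < r" "r < m" "sum4 (r * p)"
proof -
  obtain x1 x2 x3 x4 where x: "m * p = x1\<^sup>2 + x2\<^sup>2 + x3\<^sup>2 + x4\<^sup>2"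
    using s unfolding sum4_def by blast
  have nd: "\<not> m dvd p"
    using p m unfolding prime_int_iff by (metis less_irrefl less_trans order_less_imp_le zero_less_one)
  have m0: "m > 0" using m by simp
  obtain k1 where k1: "\<bar>2 * (x1 + m * k1)\<bar> \<le> m" using balanced_remainder[OF m0] by blast
  obtain k2 where k2: "\<bar>2 * (x2 + m * k2)\<bar> \<le> m" using balanced_remainder[OF m0] by blast
  obtain k3 where k3: "\<bar>2 * (x3 + m * k3)\<bar> \<le> m" using balanced_remainder[OF m0] by blast
  obtain k4 where k4: "\<bar>2 * (x4 + m * k4)\<bar> \<le> m" using balanced_remainder[OF m0] by blast
  define y1 where "y1 = x1 + m * k1"
  define y2 where "y2 = x2 + m * k2"
  define y3 where "y3 = x3 + m * k3"
  define y4 where "y4 = x4 + m * k4"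
  have xe: "x1 = y1 - m * k1" "x2 = y2 - m * k2" "x3 = y3 - m * k3" "x4 = y4 - m * k4"
    by (simp_all add: y1_def y2_def y3_def y4_def)
  define K where "K = k1\<^sup>2 + k2\<^sup>2 + k3\<^sup>2 + k4\<^sup>2"
  define Y where "Y = k1*y1 + k2*y2 + k3*y3 + k4*y4"
  \<comment> \<open>Expanding \<open>y = x + m * k\<close> and eliminating the \<open>x\<close> in
    favour of the \<open>y\<close> gives this explicit quotient by \<open>m\<close> of the sum of
    the squares of the \<open>y\<close>.\<close>
  define r where "r = p + 2 * Y - m * K"
  have mr: "y1\<^sup>2 + y2\<^sup>2 + y3\<^sup>2 + y4\<^sup>2 = m * r"
    unfolding r_def K_def Y_def using x unfolding xe by (simp add: power2_eq_square algebra_simps)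
  have sq: "4 * y\<^sup>2 \<le> m\<^sup>2" if "\<bar>2 * y\<bar> \<le> m" for y :: int
    using power_mono[OF that, of 2] by (simp add: power_mult_distrib)
  have b: "4 * y1\<^sup>2 \<le> m\<^sup>2" "4 * y2\<^sup>2 \<le> m\<^sup>2" "4 * y3\<^sup>2 \<le> m\<^sup>2" "4 * y4\<^sup>2 \<le> m\<^sup>2"
    using sq k1 k2 k3 k4 unfolding y1_def y2_def y3_def y4_def by blast+
  have "m * r \<le> m * m"
    using b mr by (simp add: power2_eq_square)
  then have rm: "r \<le> m" using m0 by simp
  have "0 \<le> m * r"
    using mr by (metis add_nonneg_nonneg zero_le_power2)
  then have r0: "0 \<le> r" using m0 by (simp add: zero_le_mult_iff)
  have "r \<noteq> 0"
  proof
    assume "r = 0"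
    then have "y1\<^sup>2 + y2\<^sup>2 + y3\<^sup>2 + y4\<^sup>2 = 0" using mr by simp
    then have "y1 = 0" "y2 = 0" "y3 = 0" "y4 = 0"
      by (smt (verit) zero_le_power2 zero_less_power2)+
    then have "m * p = m * (m * K)"
      using x unfolding xe K_def by (simp add: algebra_simps power2_eq_square)
    then show False using nd m0 by simp
  qed
  moreover have "r \<noteq> m"
  proof
    \<comment> \<open>Now all four bounds are equalities, so each \<open>2 * y\<close> is
      \<open>m\<close> or \<open>- m\<close>. Hence \<open>m\<close> divides \<open>2 * Y\<close>,
      and with it \<open>p\<close>.\<close>
    assume rm: "r = m"
    then have "4 * (y1\<^sup>2 + y2\<^sup>2 + y3\<^sup>2 + y4\<^sup>2) = 4 * m\<^sup>2" using mr by (simp add: power2_eq_square)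
    then have "4 * y1\<^sup>2 = m\<^sup>2" "4 * y2\<^sup>2 = m\<^sup>2" "4 * y3\<^sup>2 = m\<^sup>2" "4 * y4\<^sup>2 = m\<^sup>2"
      using b by - (rule antisym, simp, simp)+
    moreover have "m dvd 2 * y" if "4 * y\<^sup>2 = m\<^sup>2" for y
    proof -
      have "(2 * y)\<^sup>2 = m\<^sup>2" using that by (simp add: power_mult_distrib)
      then have "2 * y = m \<or> 2 * y = - m" by (simp only: power2_eq_iff)
      then show ?thesis by auto
    qed
    ultimately have "m dvd 2 * y1" "m dvd 2 * y2" "m dvd 2 * y3" "m dvd 2 * y4" by blast+
    then have "m dvd 2 * Y"
      unfolding Y_def by (simp add: distrib_left dvd_add mult.left_commute[of 2])
    moreover have "p = m - 2 * Y + m * K" using r_def rm by simp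
    ultimately show False using nd by simp
  qed
  ultimately have "0 < r" "r < m" using rm r0 by auto
  moreover have "sum4 (r * p)"
  proof (rule sum4I)
    have "m\<^sup>2 * (r * p) = m\<^sup>2 * ((r - Y)\<^sup>2 + (k2*y1 - k1*y2 + k4*y3 - k3*y4)\<^sup>2 +
        (k3*y1 - k1*y3 + k2*y4 - k4*y2)\<^sup>2 + (k4*y1 - k1*y4 + k3*y2 - k2*y3)\<^sup>2)"
    proof -
      have "m\<^sup>2 * (r * p) = (x1\<^sup>2 + x2\<^sup>2 + x3\<^sup>2 + x4\<^sup>2) * (y1\<^sup>2 + y2\<^sup>2 + y3\<^sup>2 + y4\<^sup>2)"
        using x mr by (simp add: power2_eq_square)
      also have "\<dots> = (x1*y1 + x2*y2 + x3*y3 + x4*y4)\<^sup>2 + (x1*y2 - x2*y1 + x3*y4 - x4*y3)\<^sup>2 +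
          (x1*y3 - x3*y1 + x4*y2 - x2*y4)\<^sup>2 + (x1*y4 - x4*y1 + x2*y3 - x3*y2)\<^sup>2"
        by (rule euler_four_square)
      also have "x1*y1 + x2*y2 + x3*y3 + x4*y4 = m * (r - Y)"
        using mr unfolding xe Y_def by (simp add: algebra_simps power2_eq_square)
      also have "x1*y2 - x2*y1 + x3*y4 - x4*y3 = m * (k2*y1 - k1*y2 + k4*y3 - k3*y4)"
        unfolding xe by (simp add: algebra_simps)
      also have "x1*y3 - x3*y1 + x4*y2 - x2*y4 = m * (k3*y1 - k1*y3 + k2*y4 - k4*y2)"
        unfolding xe by (simp add: algebra_simps)
      also have "x1*y4 - x4*y1 + x2*y3 - x3*y2 = m * (k4*y1 - k1*y4 + k3*y2 - k2*y3)"
        unfolding xe by (simp add: algebra_simps)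
      finally show ?thesis by (simp only: power_mult_distrib distrib_left)
    qed
    then show "r * p = (r - Y)\<^sup>2 + (k2*y1 - k1*y2 + k4*y3 - k3*y4)\<^sup>2 +
        (k3*y1 - k1*y3 + k2*y4 - k4*y2)\<^sup>2 + (k4*y1 - k1*y4 + k3*y2 - k2*y3)\<^sup>2"
      using m0 by simp
  qed
  ultimately show ?thesis using that by blast
qed

text \<open>Pigeonhole with \<open>p = 2 * h + 1\<close>: for arguments from 0 to \<open>h\<close>,
  the squares are distinct modulo \<open>p\<close>, and so are the values -1 minus a square.
  Together these are \<open>p + 1\<close> residues, so the two sets meet.\<close>

lemma odd_prime_dvd_two_squares_plus_1:
  fixes p :: int
  assumes p: "prime p" "odd p"
  obtains a b where "0 \<le> a" "2 * a < p" "0 \<le> b" "2 * b < p" "p dvd a\<^sup>2 + b\<^sup>2 + 1"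
proof -
  define h where "h = (p - 1) div 2"
  have ph: "p = 2 * h + 1" using p(2) h_def by (auto elim: oddE)
  have p1: "p > 1" using p(1) prime_gt_1_int by blast
  define f where "f = (\<lambda>a::int. a\<^sup>2 mod p)"
  define g where "g = (\<lambda>a::int. (- 1 - a\<^sup>2) mod p)"
  have sqinj: "a = b" if "a \<in> {0..h}" "b \<in> {0..h}" "p dvd a\<^sup>2 - b\<^sup>2" for a b
  proof -
    have "p dvd (a - b) * (a + b)" using that(3) by (simp add: algebra_simps power2_eq_square)
    then have "p dvd a - b \<or> p dvd a + b" using p(1) prime_dvd_mult_iff by blast
    moreover have "\<bar>a - b\<bar> < p" "\<bar>a + b\<bar> < p" using that ph by auto
    ultimately have "a - b = 0 \<or> a + b = 0" using dvd_imp_le_int[of "a - b" p] dvd_imp_le_int[of "a + b" p] by linarith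
    then show ?thesis using that by auto
  qed
  have f: "inj_on f {0..h}"
    using sqinj by (auto intro!: inj_onI simp: f_def mod_eq_dvd_iff)
  have g: "inj_on g {0..h}"
  proof (rule inj_onI)
    fix a b assume ab: "a \<in> {0..h}" "b \<in> {0..h}" "g a = g b"
    then have "p dvd (- 1 - a\<^sup>2) - (- 1 - b\<^sup>2)" by (simp add: g_def mod_eq_dvd_iff)
    then have "p dvd b\<^sup>2 - a\<^sup>2" by simp
    then show "a = b" using sqinj ab by blast
  qed
  have "f ` {0..h} \<inter> g ` {0..h} \<noteq> {}"
  proof
    assume e: "f ` {0..h} \<inter> g ` {0..h} = {}"
    have "card (f ` {0..h} \<union> g ` {0..h}) = nat (h + 1) + nat (h + 1)"
      using e f g by (subst card_Un_disjoint) (auto simp: card_image)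
    moreover have "f ` {0..h} \<union> g ` {0..h} \<subseteq> {0..<p}"
      using p1 by (auto simp: f_def g_def)
    then have "card (f ` {0..h} \<union> g ` {0..h}) \<le> nat p"
      using card_mono[of "{0..<p}"] by fastforce
    ultimately show False using ph p1 by linarith
  qed
  then obtain a b where ab: "a \<in> {0..h}" "b \<in> {0..h}" "f a = g b" by blast
  then have "p dvd a\<^sup>2 - (- 1 - b\<^sup>2)" by (simp add: f_def g_def mod_eq_dvd_iff)
  then have "p dvd a\<^sup>2 + b\<^sup>2 + 1" by (simp add: algebra_simps)
  then show ?thesis using that[of a b] ab ph by auto
qed

lemma sum4_prime:
  fixes p :: int
  assumes p: "prime p"
  shows "sum4 p"
proof (cases "odd p")
  case False
  then have "p = 2" using p primes_dvd_imp_eq two_is_prime_nat by (metis two_is_prime)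
  then show ?thesis by (intro sum4I[of _ 1 1 0 0]) simp
next
  case True
  obtain a b where ab: "0 \<le> a" "2 * a < p" "0 \<le> b" "2 * b < p" "p dvd a\<^sup>2 + b\<^sup>2 + 1"
    using odd_prime_dvd_two_squares_plus_1[OF p True] by blast
  have p1: "p > 1" using p prime_gt_1_int by blast
  obtain m where m: "a\<^sup>2 + b\<^sup>2 + 1 = p * m" using ab(5) by (rule dvdE)
  have "(2 * a)\<^sup>2 \<le> (p - 1)\<^sup>2" "(2 * b)\<^sup>2 \<le> (p - 1)\<^sup>2"
    by (rule power_mono; use ab in simp)+
  \<comment> \<open>The initial multiplier has to be smaller than \<open>p\<close> for the descent
    to start; this follows from \<open>2 * a\<close> and \<open>2 * b\<close> being at most
    \<open>p - 1\<close>.\<close>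
  then have "4 * (p * m) \<le> 2 * (p - 1)\<^sup>2 + 4" using m by (simp add: power_mult_distrib)
  also have "\<dots> < 4 * (p * p)" 
    using p1 mult_strict_mono[of 1 p 1 p] by (simp add: power2_eq_square algebra_simps)
  finally have mp: "m < p" using p1 by simp
  have "0 < p * m" using m by (metis add_nonneg_pos add_nonneg_nonneg zero_le_power2 zero_less_one)
  then have m0: "0 < m" using p1 by (simp add: zero_less_mult_iff)
  have s: "sum4 (m * p)" by (rule sum4I[of _ a b 1 0]) (use m in \<open>simp add: mult.commute\<close>)
  have "sum4 p" if "0 < m" "m < p" "sum4 (m * p)" for m
    using that
  proof (induction "nat m" arbitrary: m rule: less_induct)
    case less
    show ?case
    proof (cases "m = 1")
      case False
      then obtain r where "0 < r" "r < m" "sum4 (r * p)"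
        using sum4_descent[OF p] less.prems by (metis int_one_le_iff_zero_less order_le_imp_less_or_eq)
      then show ?thesis using less.hyps[of r] less.prems by auto
    qed (use less.prems in simp)
  qed
  then show ?thesis using m0 mp s by blast
qed

theorem four_squares: "sum4 (int n)"
proof (induction n rule: less_induct)
  case (less n)
  show ?case
  proof (cases "n \<le> 1")
    case True
    then have "n = 0 \<or> n = 1" by auto
    then show ?thesis
      using sum4I[of 0 0 0 0 0] sum4I[of 1 1 0 0 0] by auto
  next
    case False
    then obtain p where p: "prime p" "p dvd n" using prime_factor_nat[of n] by auto
    then obtain m where m: "n = p * m" by (elim dvdE)
    then have "m < n" using False prime_gt_1_nat[OF p(1)] by (cases "m = 0") auto
    then show ?thesis
      using sum4_mult[OF sum4_prime less.IH[of m], of "int p"] p m by simp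
  qed
qed

section \<open>Sums of squares of integral linear forms\<close>

text \<open>
  Forms in the variables \<open>x 0, \<dots>, x (n - 1)\<close> are represented as functions on integer sequences,
  which makes substitution a composition; entries from index \<open>n\<close> on are ignored.
\<close>

definition lin :: "nat \<Rightarrow> (nat \<Rightarrow> int) \<Rightarrow> (nat \<Rightarrow> int) \<Rightarrow> int" where
  "lin n c x = (\<Sum>i<n. c i * x i)"

definition sq_form :: "nat \<Rightarrow> nat \<Rightarrow> ((nat \<Rightarrow> int) \<Rightarrow> int) \<Rightarrow> bool" where
  "sq_form n N Q \<longleftrightarrow> (\<exists>c. \<forall>x. Q x = (\<Sum>k<N. (lin n (c k) x)\<^sup>2))"

definition unit_vec :: "nat \<Rightarrow> nat \<Rightarrow> int" where
  "unit_vec i = (\<lambda>j. if j = i then 1 else 0)"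

text \<open>This is the group of integral matrices with integral inverse, without matrices: pulling
  back the coordinate forms shows that the first \<open>n\<close> entries of \<open>T x\<close> are
  integral linear forms in those of \<open>x\<close>. Fixing the later entries lets the same
  \<open>T\<close> act in more variables.\<close>

definition unimodular :: "nat \<Rightarrow> ((nat \<Rightarrow> int) \<Rightarrow> (nat \<Rightarrow> int)) \<Rightarrow> bool" where
  "unimodular n T \<longleftrightarrow> bij T \<and> (\<forall>x. \<forall>i\<ge>n. T x i = x i) \<and>
     (\<forall>c. \<exists>c'. \<forall>x. lin n c (T x) = lin n c' x) \<and>
     (\<forall>c. \<exists>c'. \<forall>x. lin n c (inv T x) = lin n c' x)"

text \<open>The convex cone spanned by the squares of the integral forms in \<open>F\<close>. The
  weights are real, although the form of interest is integral.\<close>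

definition cone :: "nat \<Rightarrow> (nat \<Rightarrow> int) set \<Rightarrow> ((nat \<Rightarrow> int) \<Rightarrow> real) \<Rightarrow> bool" where
  "cone n F q \<longleftrightarrow> (\<exists>w. (\<forall>f\<in>F. 0 \<le> w f) \<and> (\<forall>x. q x = (\<Sum>f\<in>F. w f * (of_int (lin n f x))\<^sup>2)))"

lemma lin_Suc: "lin (Suc n) c x = lin n c x + c n * x n"
  by (simp add: lin_def)

lemma lin_cong: "(\<And>i. i < n \<Longrightarrow> c i = d i) \<Longrightarrow> (\<And>i. i < n \<Longrightarrow> x i = y i) \<Longrightarrow> lin n c x = lin n d y"
  by (simp add: lin_def)

lemma lin_unit_vec: "lin n c (unit_vec i) = (if i < n then c i else 0)"
proof -
  have "lin n c (unit_vec i) = (\<Sum>j<n. if j = i then c j else 0)"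
    unfolding lin_def unit_vec_def by (rule sum.cong) auto
  then show ?thesis by simp
qed

lemma unit_vec_lin: "lin n (unit_vec i) x = (if i < n then x i else 0)"
  using lin_unit_vec[of n x i] by (simp add: lin_def mult.commute)

lemma lin_add_right: "lin n c (\<lambda>i. x i + y i) = lin n c x + lin n c y"
  by (simp add: lin_def distrib_left sum.distrib)

lemma lin_add_left: "lin n (\<lambda>i. c i + d i) x = lin n c x + lin n d x"
  by (simp add: lin_def distrib_right sum.distrib)

lemma lin_mult_left: "lin n (\<lambda>i. a * c i) x = a * lin n c x"
  by (simp add: lin_def sum_distrib_left mult.assoc)

lemma lin_diff_left: "lin n (\<lambda>i. c i - d i) x = lin n c x - lin n d x"
  by (simp add: lin_def left_diff_distrib sum_subtractf)

lemma lin_sum_left: "lin n (\<lambda>i. \<Sum>k\<in>K. a k * c k i) x = (\<Sum>k\<in>K. a k * lin n (c k) x)"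
  unfolding lin_def sum_distrib_left sum_distrib_right
  by (subst sum.swap) (simp add: mult.assoc)

lemma lin_upd: "lin n c (x(n := a)) = lin n c x"
  by (rule lin_cong) auto

lemma lin_upd_left: "lin n (c(n := a)) x = lin n c x"
  by (rule lin_cong) auto

section \<open>Sums of squares under addition and substitution\<close>

lemma sq_formI:
  assumes "finite I" "\<And>x. Q x = (\<Sum>i\<in>I. (lin n (c i) x)\<^sup>2)"
  shows "sq_form n (card I) Q"
proof -
  obtain h where h: "bij_betw h {0..<card I} I" using ex_bij_betw_nat_finite[OF assms(1)] by blast
  have "Q x = (\<Sum>k<card I. (lin n (c (h k)) x)\<^sup>2)" for x
    unfolding assms(2) using sum.reindex_bij_betw[OF h, of "\<lambda>i. (lin n (c i) x)\<^sup>2"]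
    by (simp add: lessThan_atLeast0)
  then show ?thesis unfolding sq_form_def by (intro exI[of _ "\<lambda>k. c (h k)"]) blast
qed

lemma sq_form_pullback:
  assumes "sq_form n N Q" "\<And>c. \<exists>c'. \<forall>x. lin n c (T x) = lin m c' x"
  shows "sq_form m N (\<lambda>x. Q (T x))"
proof -
  obtain c where c: "\<And>x. Q x = (\<Sum>k<N. (lin n (c k) x)\<^sup>2)" using assms(1) sq_form_def by blast
  have "\<forall>k. \<exists>d. \<forall>x. lin n (c k) (T x) = lin m d x" using assms(2) by blast
  then obtain d where "\<And>k x. lin n (c k) (T x) = lin m (d k) x" by metis
  then show ?thesis unfolding sq_form_def c by auto
qed

lemma sq_form_add:
  assumes "sq_form n N Q" "sq_form n M R"
  shows "sq_form n (N + M) (\<lambda>x. Q x + R x)"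
proof -
  obtain c where c: "\<And>x. Q x = (\<Sum>k<N. (lin n (c k) x)\<^sup>2)" using assms(1) sq_form_def by blast
  obtain d where d: "\<And>x. R x = (\<Sum>k<M. (lin n (d k) x)\<^sup>2)" using assms(2) sq_form_def by blast
  have "card (Inl ` {..<N} \<union> Inr ` {..<M}) = N + M"
    by (subst card_Un_disjoint) (auto simp: card_image)
  moreover have "sq_form n (card (Inl ` {..<N} \<union> Inr ` {..<M})) (\<lambda>x. Q x + R x)"
  proof (rule sq_formI[where c = "case_sum c d"])
    fix x
    show "Q x + R x = (\<Sum>i\<in>Inl ` {..<N} \<union> Inr ` {..<M}. (lin n (case_sum c d i) x)\<^sup>2)"
      unfolding c d by (subst sum.union_disjoint) (auto simp: sum.reindex)
  qed simp
  ultimately show ?thesis by simp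
qed

lemma sq_form_0: "sq_form n N (\<lambda>x. 0)"
  unfolding sq_form_def by (rule exI[of _ "\<lambda>_ _. 0"]) (simp add: lin_def)

lemma sq_form_mono: "sq_form n N Q \<Longrightarrow> N \<le> M \<Longrightarrow> sq_form n M Q"
  using sq_form_add[OF _ sq_form_0, of n N Q "M - N"] by simp

lemma sq_form_sum:
  assumes "finite I" "\<And>i. i \<in> I \<Longrightarrow> sq_form n M (Q i)"
  shows "sq_form n (M * card I) (\<lambda>x. \<Sum>i\<in>I. Q i x)"
  using assms
proof (induction I rule: finite_induct)
  case (insert i I)
  then show ?case using sq_form_add[of n M "Q i" "M * card I"] by simp
qed (simp add: sq_form_0)

text \<open>Writing \<open>m\<close> as four squares and distributing them over \<open>f\<close>
  makes the number of squares independent of \<open>m\<close>.\<close>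

lemma sq_form_multiple:
  "sq_form n 4 (\<lambda>x. int m * (lin n f x)\<^sup>2)"
proof -
  obtain a b c d where m: "int m = a\<^sup>2 + b\<^sup>2 + c\<^sup>2 + d\<^sup>2"
    using four_squares[of m] unfolding sum4_def by blast
  have "int m * (lin n f x)\<^sup>2 = (\<Sum>k<4. (lin n (\<lambda>i. ([a, b, c, d] ! k) * f i) x)\<^sup>2)" for x
    by (simp add: lin_mult_left m eval_nat_numeral algebra_simps power_mult_distrib)
  then show ?thesis unfolding sq_form_def
    by (intro exI[of _ "\<lambda>k i. ([a, b, c, d] ! k) * f i"]) blast
qed

lemma sq_form_nonneg: "sq_form n N Q \<Longrightarrow> 0 \<le> Q x"
  unfolding sq_form_def by (auto intro!: sum_nonneg)

section \<open>Unimodular substitutions\<close>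

lemma unimodular_id: "unimodular n (\<lambda>x. x)"
  unfolding unimodular_def by (auto simp: bij_def inv_equality inj_def surj_def intro: exI)

lemma unimodular_comp:
  assumes "unimodular n S" "unimodular n T"
  shows "unimodular n (\<lambda>x. S (T x))"
proof -
  have "bij (S \<circ> T)" using assms unfolding unimodular_def by (blast intro: bij_comp)
  moreover have "inv (S \<circ> T) = inv T \<circ> inv S"
    using assms unfolding unimodular_def by (intro o_inv_distrib) auto
  ultimately show ?thesis
    using assms unfolding unimodular_def by (auto simp: o_def) metis+
qed

lemma unimodular_pullback: "unimodular n T \<Longrightarrow> \<exists>c'. \<forall>x. lin n c (T x) = lin n c' x"
  unfolding unimodular_def by blast

text \<open>The new variable has index \<open>n\<close> and is fixed by \<open>T\<close>, so its
  coefficient is carried over unchanged. This lifts substitutions from the induction hypothesis of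
  the reduction.\<close>

lemma unimodular_Suc:
  assumes "unimodular n T"
  shows "unimodular (Suc n) T"
proof -
  have T: "bij T" "\<And>x i. i \<ge> n \<Longrightarrow> T x i = x i" using assms unfolding unimodular_def by blast+
  then have I: "inv T x i = x i" if "i \<ge> n" for x i
    using that by (metis bij_inv_eq_iff)
  have "\<exists>c'. \<forall>x. lin (Suc n) c (T x) = lin (Suc n) c' x" for c
  proof -
    obtain d where "\<And>x. lin n c (T x) = lin n d x" using assms unfolding unimodular_def by blast
    then show ?thesis by (intro exI[of _ "d(n := c n)"]) (simp add: lin_Suc T lin_upd_left)
  qed
  moreover have "\<exists>c'. \<forall>x. lin (Suc n) c (inv T x) = lin (Suc n) c' x" for c
  proof -
    obtain d where "\<And>x. lin n c (inv T x) = lin n d x" using assms unfolding unimodular_def by blast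
    then show ?thesis by (intro exI[of _ "d(n := c n)"]) (simp add: lin_Suc I lin_upd_left)
  qed
  ultimately show ?thesis using T unfolding unimodular_def by auto
qed

lemma unimodularI:
  assumes "\<And>x. S (T x) = x" "\<And>x. T (S x) = x" "\<And>x i. i \<ge> n \<Longrightarrow> T x i = x i"
    "\<And>c. \<exists>c'. \<forall>x. lin n c (T x) = lin n c' x" "\<And>c. \<exists>c'. \<forall>x. lin n c (S x) = lin n c' x"
  shows "unimodular n T"
proof -
  have "bij T" using assms(1,2) by (metis bijI')
  moreover have "inv T = S" using assms(1,2) by (intro inv_equality)
  ultimately show ?thesis using assms(3-5) unfolding unimodular_def by auto
qed

lemma unimodular_shear: "unimodular (Suc n) (\<lambda>x. x(n := x n + lin n k x))"
proof (rule unimodularI[where S = "\<lambda>x. x(n := x n - lin n k x)"])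
  fix c
  show "\<exists>c'. \<forall>x. lin (Suc n) c (x(n := x n + lin n k x)) = lin (Suc n) c' x"
    by (rule exI[of _ "\<lambda>i. if i < n then c i + c n * k i else c i"])
       (simp add: lin_Suc lin_upd, simp add: lin_def sum.distrib sum_distrib_left algebra_simps)
  show "\<exists>c'. \<forall>x. lin (Suc n) c (x(n := x n - lin n k x)) = lin (Suc n) c' x"
    by (rule exI[of _ "\<lambda>i. if i < n then c i - c n * k i else c i"])
       (simp add: lin_Suc lin_upd, simp add: lin_def sum_subtractf sum_distrib_left algebra_simps)
qed (auto simp: lin_upd)

lemma unimodular_swap:
  assumes "i \<le> n"
  shows "unimodular (Suc n) (\<lambda>x. x(i := x n, n := x i))"
proof -
  let ?t = "id(i := n, n := i)"
  have eq: "x(i := x n, n := x i) = x \<circ> ?t" for x :: "nat \<Rightarrow> int"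
    by auto
  have b: "bij_betw (?t) {..<Suc n} {..<Suc n}"
    using assms by (intro bij_betw_byWitness[where f' = "?t"]) auto
  have "\<exists>c'. \<forall>x. lin (Suc n) c (x(i := x n, n := x i)) = lin (Suc n) c' x" for c
  proof (intro exI allI)
    fix x
    have "?t (?t j) = j" for j by auto
    then show "lin (Suc n) c (x(i := x n, n := x i)) = lin (Suc n) (c \<circ> ?t) x"
      unfolding eq lin_def using sum.reindex_bij_betw[OF b, of "\<lambda>j. c j * x (?t j)"]
      by (simp only: o_def)
  qed
  then show ?thesis using assms
    by (intro unimodularI[where S = "\<lambda>x. x(i := x n, n := x i)"]) auto
qed

section \<open>Cones spanned by squares of linear forms\<close>

lemma cone_add:
  assumes "cone n F q" "cone n F r"
  shows "cone n F (\<lambda>x. q x + r x)"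
proof -
  obtain u where u: "\<And>f. f \<in> F \<Longrightarrow> 0 \<le> u f" "\<And>x. q x = (\<Sum>f\<in>F. u f * (of_int (lin n f x))\<^sup>2)"
    using assms(1) unfolding cone_def by blast
  obtain v where v: "\<And>f. f \<in> F \<Longrightarrow> 0 \<le> v f" "\<And>x. r x = (\<Sum>f\<in>F. v f * (of_int (lin n f x))\<^sup>2)"
    using assms(2) unfolding cone_def by blast
  show ?thesis unfolding cone_def
    by (rule exI[of _ "\<lambda>f. u f + v f"]) (simp add: u v sum.distrib distrib_right)
qed

lemma cone_scale:
  assumes "cone n F q" "0 \<le> a"
  shows "cone n F (\<lambda>x. a * q x)"
proof -
  obtain u where u: "\<And>f. f \<in> F \<Longrightarrow> 0 \<le> u f" "\<And>x. q x = (\<Sum>f\<in>F. u f * (of_int (lin n f x))\<^sup>2)"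
    using assms(1) unfolding cone_def by blast
  show ?thesis unfolding cone_def
    by (rule exI[of _ "\<lambda>f. a * u f"]) (simp add: u assms sum_distrib_left mult.assoc)
qed

lemma cone_0: "cone n F (\<lambda>x. 0)"
  unfolding cone_def by (rule exI[of _ "\<lambda>_. 0"]) simp

lemma cone_sum:
  assumes "\<And>i. i \<in> I \<Longrightarrow> cone n F (q i)"
  shows "cone n F (\<lambda>x. \<Sum>i\<in>I. q i x)"
  using assms by (induction I rule: infinite_finite_induct) (auto simp: cone_0 cone_add)

lemma cone_square:
  assumes "finite F" "f \<in> F" "0 \<le> a"
  shows "cone n F (\<lambda>x. a * (of_int (lin n f x))\<^sup>2)"
proof -
  have "(\<Sum>g\<in>F. (if g = f then a else 0) * (real_of_int (lin n g x))\<^sup>2) = a * (of_int (lin n f x))\<^sup>2" for x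
    using assms by (subst sum.remove[of _ f]) auto
  then show ?thesis unfolding cone_def using assms
    by (intro exI[of _ "\<lambda>g. if g = f then a else 0"]) auto
qed

text \<open>Substitution turns generators into generators. As \<open>h\<close> may identify some of
  them, the image is rebuilt as a sum of single squares, whose weights then accumulate.\<close>

lemma cone_transfer:
  assumes "cone n F q" "finite G" "\<And>f. f \<in> F \<Longrightarrow> h f \<in> G"
    "\<And>f x. f \<in> F \<Longrightarrow> lin n f (T x) = lin m (h f) x"
  shows "cone m G (\<lambda>x. q (T x))"
proof -
  obtain u where u: "\<And>f. f \<in> F \<Longrightarrow> 0 \<le> u f" "\<And>x. q x = (\<Sum>f\<in>F. u f * (of_int (lin n f x))\<^sup>2)"
    using assms(1) unfolding cone_def by blast
  have "q (T x) = (\<Sum>f\<in>F. u f * (of_int (lin m (h f) x))\<^sup>2)" for x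
    unfolding u by (rule sum.cong) (auto simp: assms(4))
  moreover have "cone m G (\<lambda>x. \<Sum>f\<in>F. u f * (of_int (lin m (h f) x))\<^sup>2)"
    using assms u by (intro cone_sum cone_square) auto
  ultimately show ?thesis by simp
qed

lemma cone_mono: "cone n F q \<Longrightarrow> finite G \<Longrightarrow> F \<subseteq> G \<Longrightarrow> cone n G q"
  using cone_transfer[of n F q G "\<lambda>f. f" "\<lambda>x. x" n] by auto

section \<open>Diagonally dominant forms and perturbed squares\<close>

definition pair_vecs :: "nat \<Rightarrow> (nat \<Rightarrow> int) set" where
  "pair_vecs n = (\<lambda>(i, j, s) k. unit_vec i k + s * unit_vec j k) ` ({..<n} \<times> {..<n} \<times> {-1, 0, 1})"

lemma finite_pair_vecs: "finite (pair_vecs n)"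
  by (simp add: pair_vecs_def)

lemma cone_pair_vecs:
  assumes "i < n" "j < n" "s \<in> {-1, 0, 1}" "0 \<le> a"
  shows "cone n (pair_vecs n) (\<lambda>x. a * (of_int (x i + s * x j))\<^sup>2)"
proof -
  let ?f = "\<lambda>k. unit_vec i k + s * unit_vec j k"
  have "lin n ?f x = x i + s * x j" for x
    using assms by (simp add: lin_add_left lin_mult_left unit_vec_lin)
  moreover have "?f \<in> pair_vecs n"
    unfolding pair_vecs_def using assms by (intro image_eqI[of _ _ "(i, j, s)"]) auto
  ultimately show ?thesis using cone_square[OF finite_pair_vecs _ assms(4), of ?f n n] by simp
qed

text \<open>A mixed term \<open>e * a * b\<close> equals \<open>\<bar>e\<bar> / 2\<close> times the
  square of \<open>a + b\<close> or \<open>a - b\<close>, according to the sign of \<open>e\<close>,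
  up to \<open>\<bar>e\<bar> / 2\<close> times \<open>a\<^sup>2 + b\<^sup>2\<close>. Granting
  \<open>\<kappa> / 2\<close> of both squares to every ordered pair costs
  \<open>\<kappa> * n\<close> per variable in total.\<close>

lemma cone_diagonally_dominant:
  fixes E :: "nat \<Rightarrow> nat \<Rightarrow> real"
  assumes "\<And>i j. i < n \<Longrightarrow> j < n \<Longrightarrow> \<bar>E i j\<bar> \<le> \<kappa>"
  shows "cone n (pair_vecs n) (\<lambda>x. (\<Sum>i<n. \<Sum>j<n. E i j * of_int (x i) * of_int (x j)) +
    \<kappa> * n * (\<Sum>i<n. (of_int (x i))\<^sup>2))"
proof -
  define t where "t = (\<lambda>i j x. \<bar>E i j\<bar> / 2 * (real_of_int (x i + (if 0 \<le> E i j then 1 else - 1) * x j))\<^sup>2 +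
    ((\<kappa> / 2 - \<bar>E i j\<bar> / 2) * (real_of_int (x i + 0 * x j))\<^sup>2 +
     (\<kappa> / 2 - \<bar>E i j\<bar> / 2) * (real_of_int (x j + 0 * x i))\<^sup>2))"
  have "cone n (pair_vecs n) (t i j)" if "i < n" "j < n" for i j
    unfolding t_def using that assms[OF that] by (intro cone_add cone_pair_vecs) auto
  then have "cone n (pair_vecs n) (\<lambda>x. \<Sum>i<n. \<Sum>j<n. t i j x)"
    by (intro cone_sum) auto
  moreover have "t i j x = E i j * of_int (x i) * of_int (x j) +
      (\<kappa> / 2 * (of_int (x i))\<^sup>2 + \<kappa> / 2 * (of_int (x j))\<^sup>2)" for i j x
  proof -
    have "\<bar>e\<bar> / 2 * (a + (if 0 \<le> e then 1 else - 1) * b)\<^sup>2 +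
        ((\<kappa> / 2 - \<bar>e\<bar> / 2) * a\<^sup>2 + (\<kappa> / 2 - \<bar>e\<bar> / 2) * b\<^sup>2) =
        e * a * b + (\<kappa> / 2 * a\<^sup>2 + \<kappa> / 2 * b\<^sup>2)" for e a b :: real
      by (cases "0 \<le> e") (simp_all add: power2_eq_square algebra_simps)
    from this[of "E i j" "of_int (x i)" "of_int (x j)"] show ?thesis
      unfolding t_def by (cases "0 \<le> E i j") simp_all
  qed
  then have "(\<Sum>i<n. \<Sum>j<n. t i j x) = (\<Sum>i<n. \<Sum>j<n. E i j * of_int (x i) * of_int (x j)) +
    \<kappa> * n * (\<Sum>i<n. (of_int (x i))\<^sup>2)" for x
    by (simp only: sum.distrib sum_constant card_lessThan flip: sum_distrib_left) (simp add: algebra_simps)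
  ultimately show ?thesis by simp
qed

text \<open>
  Approximate \<open>\<mu>\<close> by \<open>\<nu> = p / N\<close> on a finite grid. In the coordinates \<open>x\<^sub>n + \<nu> x\<close> and \<open>x\<^sub>j\<close>, scaled by
  \<open>N\<close> to be integral, the form is a small perturbation of a diagonal one, hence diagonally dominant.
\<close>

lemma cone_perturbed_square:
  fixes \<eta> :: real
  assumes "0 < \<eta>"
  obtains G \<epsilon> where "finite G" "0 < \<epsilon>"
    "\<And>\<mu>. (\<And>j. j < n \<Longrightarrow> \<bar>\<mu> j\<bar> \<le> 1) \<Longrightarrow>
      cone (Suc n) G (\<lambda>x. (of_int (x n) + (\<Sum>j<n. \<mu> j * of_int (x j)))\<^sup>2 +
        \<eta> * (\<Sum>j<n. (of_int (x j))\<^sup>2) - \<epsilon> * (\<Sum>j<Suc n. (of_int (x j))\<^sup>2))"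
proof -
  define m where "m = min 1 \<eta>"
  have m: "0 < m" "m \<le> 1" "m \<le> \<eta>" using assms by (auto simp: m_def)
  \<comment> \<open>With \<open>\<epsilon> = 1 / N\<close> and
    \<open>\<kappa> = 2 * \<epsilon>\<close>, the number \<open>2 * n + 3\<close> is the multiple of
    \<open>\<epsilon>\<close> in \<open>\<kappa> * Suc n + \<epsilon>\<close>. Keeping this below
    both 1 and \<open>\<eta>\<close> makes the leftover diagonal coefficients in \<open>q\<close>
    nonnegative.\<close>
  obtain N :: nat where N: "(2 * real n + 3) / m \<le> real N" using real_arch_simple by blast
  moreover have "0 < (2 * real n + 3) / m" using m by (intro divide_pos_pos) auto
  ultimately have N0: "0 < N" by linarith
  define \<epsilon> where "\<epsilon> = 1 / real N"
  define \<kappa> where "\<kappa> = 2 * \<epsilon>"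
  have \<epsilon>0: "0 < \<epsilon>" using N0 by (simp add: \<epsilon>_def)
  have "(2 * real n + 3) * \<epsilon> \<le> m"
    using N N0 m by (simp add: \<epsilon>_def field_simps)
  then have k: "\<kappa> * real (Suc n) \<le> 1" "\<kappa> * real (Suc n) + \<epsilon> \<le> \<eta>"
    using \<epsilon>0 m by (simp_all add: \<kappa>_def algebra_simps)
  \<comment> \<open>\<open>Z p\<close> is the scaled change of coordinates and \<open>h p\<close> is
    its transpose, acting on coefficient vectors; \<open>hZ\<close> is their adjointness.\<close>
  define Z where "Z = (\<lambda>(p::nat \<Rightarrow> int) (x::nat \<Rightarrow> int) i. if i < n then int N * x i else int N * x n + lin n p x)"
  define h where "h = (\<lambda>(p::nat \<Rightarrow> int) (f::nat \<Rightarrow> int) i. if i < n then int N * f i + f n * p i else int N * f n)"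
  have hZ: "lin (Suc n) f (Z p x) = lin (Suc n) (h p f) x" for f p x
    by (simp add: lin_Suc Z_def h_def, simp add: lin_def algebra_simps sum.distrib sum_distrib_left)
  define G where "G = (\<lambda>(p, f). h p f) ` (({..<n} \<rightarrow>\<^sub>E {- int N..int N}) \<times> pair_vecs (Suc n))"
  have "finite G" unfolding G_def by (intro finite_imageI finite_cartesian_product finite_PiE finite_pair_vecs) auto
  moreover have "cone (Suc n) G (\<lambda>x. (of_int (x n) + (\<Sum>j<n. \<mu> j * of_int (x j)))\<^sup>2 +
        \<eta> * (\<Sum>j<n. (of_int (x j))\<^sup>2) - \<epsilon> * (\<Sum>j<Suc n. (of_int (x j))\<^sup>2))"
    if \<mu>: "\<And>j. j < n \<Longrightarrow> \<bar>\<mu> j\<bar> \<le> 1" for \<mu>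
  proof -
    define p where "p = restrict (\<lambda>j. \<lfloor>N * \<mu> j\<rfloor>) {..<n}"
    have pN: "p \<in> {..<n} \<rightarrow>\<^sub>E {- int N..int N}"
    proof -
      have "- int N \<le> \<lfloor>N * \<mu> j\<rfloor> \<and> \<lfloor>N * \<mu> j\<rfloor> \<le> int N" if "j < n" for j
      proof -
        have "\<bar>real N * \<mu> j\<bar> \<le> real N"
          using \<mu>[OF that] by (simp add: abs_mult mult_left_le)
        then show ?thesis by linarith
      qed
      then show ?thesis unfolding p_def by auto
    qed
    define \<nu> where "\<nu> = (\<lambda>j. p j / N)"
    define \<delta> where "\<delta> = (\<lambda>j. \<mu> j - \<nu> j)"
    have \<nu>: "\<bar>\<nu> j\<bar> \<le> 1" if "j < n" for j
    proof -
      have "\<bar>p j\<bar> \<le> int N" using PiE_mem[OF pN, of j] that by (simp add: abs_le_iff)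
      then have "real_of_int \<bar>p j\<bar> \<le> real_of_int (int N)" by (rule of_int_le_iff[THEN iffD2])
      then show ?thesis using N0 by (simp add: \<nu>_def)
    qed
    have \<delta>: "0 \<le> \<delta> j" "\<delta> j \<le> \<epsilon>" if "j < n" for j
    proof -
      have "real_of_int \<lfloor>N * \<mu> j\<rfloor> \<le> N * \<mu> j" "N * \<mu> j \<le> real_of_int \<lfloor>N * \<mu> j\<rfloor> + 1" by linarith+
      moreover have e: "\<delta> j = (N * \<mu> j - \<lfloor>N * \<mu> j\<rfloor>) / N"
        using that N0 by (simp add: \<delta>_def \<nu>_def p_def diff_divide_distrib)
      ultimately show "0 \<le> \<delta> j" "\<delta> j \<le> \<epsilon>"
        using that N0 unfolding e \<epsilon>_def
        by - ((rule divide_nonneg_nonneg | rule divide_right_mono); linarith)+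
    qed
    have \<epsilon>1: "\<epsilon> \<le> 1" using N0 by (simp add: \<epsilon>_def)
    \<comment> \<open>In the coordinates \<open>x i\<close> for \<open>i < n\<close> and
      \<open>x n + \<nu> x\<close>, the vector \<open>a\<close> represents
      \<open>x n + \<mu> x\<close> and \<open>b\<close> represents \<open>x n\<close>. Thus
      \<open>E\<close> is the matrix of the given square minus \<open>\<epsilon>\<close> times
      \<open>(x n)\<^sup>2\<close> minus the square of the last coordinate, and its entries are of
      size \<open>\<epsilon>\<close>.\<close>
    define a where "a = (\<lambda>i. if i < n then \<delta> i else 1)"
    define b where "b = (\<lambda>i. if i < n then - \<nu> i else 1)"
    define E where "E = (\<lambda>i j. a i * a j - \<epsilon> * (b i * b j) - (if i = n \<and> j = n then 1 else 0))"
    have "\<bar>E i j\<bar> \<le> \<kappa>" if "i < Suc n" "j < Suc n" for i j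
    proof -
      have b1: "\<bar>b i\<bar> \<le> 1" "\<bar>b j\<bar> \<le> 1" using \<nu> by (auto simp: b_def)
      then have "\<bar>b i * b j\<bar> \<le> 1" by (metis abs_ge_zero abs_mult mult_le_one)
      then have "\<bar>\<epsilon> * (b i * b j)\<bar> \<le> \<epsilon>" using \<epsilon>0 by (simp add: abs_mult mult_left_le)
      moreover have "\<bar>a i * a j - (if i = n \<and> j = n then 1 else 0)\<bar> \<le> \<epsilon>"
      proof (cases "i < n \<and> j < n")
        case True
        then have "\<delta> i * \<delta> j \<le> \<epsilon> * 1" using \<delta> \<epsilon>1 by (intro mult_mono) (auto intro: order_trans)
        then show ?thesis using True \<delta> by (auto simp: a_def)
      next
        case False
        then show ?thesis using that \<delta> \<epsilon>0 by (auto simp: a_def)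
      qed
      ultimately show ?thesis unfolding E_def \<kappa>_def by linarith
    qed
    then have D: "cone (Suc n) (pair_vecs (Suc n)) (\<lambda>x. (\<Sum>i<Suc n. \<Sum>j<Suc n. E i j * of_int (x i) * of_int (x j)) +
        \<kappa> * Suc n * (\<Sum>i<Suc n. (of_int (x i))\<^sup>2))"
      by (rule cone_diagonally_dominant)
    \<comment> \<open>The factor \<open>\<epsilon>\<^sup>2\<close> undoes the scaling by
      \<open>N\<close> in \<open>Z\<close>. A share \<open>\<kappa> * Suc n\<close> of each diagonal
      coefficient pays for the dominance of \<open>E\<close>; the rest stays as plain squares,
      written with \<open>0 *\<close> to match the generators in \<open>pair_vecs\<close>.\<close>
    define q where "q = (\<lambda>z. \<epsilon>\<^sup>2 * (((\<Sum>i<Suc n. \<Sum>j<Suc n. E i j * of_int (z i) * of_int (z j)) +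
        \<kappa> * Suc n * (\<Sum>i<Suc n. (of_int (z i))\<^sup>2)) +
        ((1 - \<kappa> * Suc n) * (real_of_int (z n + 0 * z n))\<^sup>2 +
         (\<Sum>i<n. (\<eta> - \<epsilon> - \<kappa> * Suc n) * (real_of_int (z i + 0 * z i))\<^sup>2))))"
    have "cone (Suc n) (pair_vecs (Suc n)) q"
      unfolding q_def using k \<epsilon>0 by (intro cone_scale cone_add D cone_sum cone_pair_vecs) auto
    then have "cone (Suc n) G (\<lambda>x. q (Z p x))"
      by (rule cone_transfer[where h = "h p"]) (use \<open>finite G\<close> pN in \<open>auto simp: hZ G_def\<close>)
    moreover have "q (Z p x) = (of_int (x n) + (\<Sum>j<n. \<mu> j * of_int (x j)))\<^sup>2 +
        \<eta> * (\<Sum>j<n. (of_int (x j))\<^sup>2) - \<epsilon> * (\<Sum>j<Suc n. (of_int (x j))\<^sup>2)" for x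
    proof -
      define y where "y = (\<lambda>i. \<epsilon> * real_of_int (Z p x i))"
      have y: "y i = of_int (x i)" if "i < n" for i
        using that N0 by (simp add: y_def Z_def \<epsilon>_def)
      have yn: "y n = of_int (x n) + (\<Sum>j<n. \<nu> j * of_int (x j))"
        using N0 by (simp add: y_def Z_def \<epsilon>_def lin_def \<nu>_def add_divide_distrib sum_divide_distrib)
      have quad: "(\<Sum>i<Suc n. c i * y i)\<^sup>2 = (\<Sum>i<Suc n. \<Sum>j<Suc n. c i * c j * y i * y j)" for c
        unfolding power2_eq_square sum_product by (simp add: mult_ac)
      have "q (Z p x) = (\<Sum>i<Suc n. \<Sum>j<Suc n. E i j * y i * y j) +
        \<kappa> * Suc n * (\<Sum>i<Suc n. (y i)\<^sup>2) + (1 - \<kappa> * Suc n) * (y n)\<^sup>2 +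
         (\<eta> - \<epsilon> - \<kappa> * Suc n) * (\<Sum>i<n. (y i)\<^sup>2)"
      proof -
        have "(\<Sum>i<Suc n. \<Sum>j<Suc n. E i j * y i * y j) =
            \<epsilon>\<^sup>2 * (\<Sum>i<Suc n. \<Sum>j<Suc n. E i j * of_int (Z p x i) * of_int (Z p x j))"
          unfolding sum_distrib_left y_def power2_eq_square by (intro sum.cong refl) (simp only: mult_ac)
        moreover have "(\<Sum>i<m. (y i)\<^sup>2) = \<epsilon>\<^sup>2 * (\<Sum>i<m. (of_int (Z p x i))\<^sup>2)" for m
          by (simp add: y_def power_mult_distrib sum_distrib_left)
        moreover have "(y n)\<^sup>2 = \<epsilon>\<^sup>2 * (of_int (Z p x n))\<^sup>2"
          by (simp add: y_def power_mult_distrib)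
        ultimately show ?thesis
          unfolding q_def by (simp add: distrib_left mult.left_commute[of "\<epsilon>\<^sup>2"] del: sum.lessThan_Suc flip: sum_distrib_left)
      qed
      also have "(\<Sum>i<Suc n. \<Sum>j<Suc n. E i j * y i * y j) =
          (\<Sum>i<Suc n. a i * y i)\<^sup>2 - \<epsilon> * (\<Sum>i<Suc n. b i * y i)\<^sup>2 - (y n)\<^sup>2"
      proof -
        have "(\<Sum>i<Suc n. \<Sum>j<Suc n. (if i = n \<and> j = n then 1 else 0) * y i * y j) = (y n)\<^sup>2"
          by (simp add: power2_eq_square)
        moreover have "E i j * y i * y j = a i * a j * y i * y j - \<epsilon> * (b i * b j * y i * y j) -
            (if i = n \<and> j = n then 1 else 0) * y i * y j" for i j
          unfolding E_def by (simp only: left_diff_distrib mult.assoc)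
        ultimately show ?thesis unfolding quad
          by (simp only: sum_subtractf sum_distrib_left)
      qed
      also have "(\<Sum>i<Suc n. a i * y i) = of_int (x n) + (\<Sum>j<n. \<mu> j * of_int (x j))"
        by (simp add: a_def y yn \<delta>_def left_diff_distrib sum_subtractf)
      also have "(\<Sum>i<Suc n. b i * y i) = of_int (x n)"
        by (simp add: b_def y yn sum_negf)
      finally show ?thesis by (simp add: y algebra_simps)
    qed
    ultimately show ?thesis by simp
  qed
  ultimately show ?thesis using that \<epsilon>0 by blast
qed

section \<open>Reduction theory\<close>

lemma sq_form_upd: "sq_form n N Q \<Longrightarrow> Q (x(n := a)) = Q x"
  unfolding sq_form_def by (auto simp: lin_upd)

text \<open>It shows that the remainder after completing a square is itself a sum of squares.
  Summing over ordered pairs produces the factor 2 and avoids division.\<close>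

lemma lagrange_identity:
  fixes a u :: "nat \<Rightarrow> 'a::comm_ring_1"
  shows "(\<Sum>k<N. \<Sum>l<N. (a k * u l - a l * u k)\<^sup>2) =
    2 * (\<Sum>k<N. (a k)\<^sup>2) * (\<Sum>k<N. (u k)\<^sup>2) - 2 * (\<Sum>k<N. a k * u k)\<^sup>2"
proof -
  have "(a k * u l - a l * u k)\<^sup>2 = (a k)\<^sup>2 * (u l)\<^sup>2 + (u k)\<^sup>2 * (a l)\<^sup>2 - 2 * ((a k * u k) * (a l * u l))" for k l
    by (simp add: power2_eq_square algebra_simps)
  then have "(\<Sum>k<N. \<Sum>l<N. (a k * u l - a l * u k)\<^sup>2) =
      (\<Sum>k<N. (a k)\<^sup>2) * (\<Sum>l<N. (u l)\<^sup>2) + (\<Sum>k<N. (u k)\<^sup>2) * (\<Sum>l<N. (a l)\<^sup>2) -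
      2 * ((\<Sum>k<N. a k * u k) * (\<Sum>l<N. a l * u l))"
    unfolding sum_product by (simp only: sum_subtractf sum.distrib sum_distrib_left)
  then show ?thesis by (simp add: power2_eq_square algebra_simps)
qed

text \<open>Apply Lagrange's identity to the coefficients of \<open>x n\<close> in the given linear
  forms and to the values of these forms. In each difference of products \<open>x n\<close> cancels,
  so the remainder \<open>B\<close> is an integral sum of squares in \<open>n\<close> variables. If
  the diagonal coefficient is 0, no form contains \<open>x n\<close>.\<close>

lemma sq_form_complete_square:
  assumes "sq_form (Suc n) N Q"
  obtains b M B where "sq_form n M B"
    "\<And>x. 2 * Q (unit_vec n) * Q x = 2 * (Q (unit_vec n) * x n + lin n b x)\<^sup>2 + B x"
    "Q (unit_vec n) = 0 \<Longrightarrow> sq_form n N Q"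
proof -
  obtain c where c: "\<And>x. Q x = (\<Sum>k<N. (lin (Suc n) (c k) x)\<^sup>2)" using assms sq_form_def by blast
  define d where "d = (\<Sum>k<N. (c k n)\<^sup>2)"
  have d: "Q (unit_vec n) = d" by (simp add: c d_def lin_unit_vec)
  define b where "b = (\<lambda>i. \<Sum>k<N. c k n * c k i)"
  define B where "B = (\<lambda>x. \<Sum>(k, l)\<in>{..<N}\<times>{..<N}. (lin n (\<lambda>i. c k n * c l i - c l n * c k i) x)\<^sup>2)"
  have "sq_form n (card ({..<N}\<times>{..<N})) B"
    unfolding B_def by (rule sq_formI[where c = "\<lambda>(k, l) i. c k n * c l i - c l n * c k i"]) (auto intro: sum.cong)
  moreover have "2 * d * Q x = 2 * (d * x n + lin n b x)\<^sup>2 + B x" for x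
  proof -
    have "B x = (\<Sum>k<N. \<Sum>l<N. (c k n * lin (Suc n) (c l) x - c l n * lin (Suc n) (c k) x)\<^sup>2)"
      unfolding B_def sum.cartesian_product lin_diff_left lin_mult_left lin_Suc
      by (intro sum.cong refl) (auto simp: algebra_simps)
    also have "\<dots> = 2 * d * Q x - 2 * (\<Sum>k<N. c k n * lin (Suc n) (c k) x)\<^sup>2"
      unfolding lagrange_identity d_def c ..
    also have "(\<Sum>k<N. c k n * lin (Suc n) (c k) x) = d * x n + lin n b x"
      unfolding b_def lin_sum_left d_def lin_Suc
      by (simp add: sum_distrib_left sum.distrib algebra_simps power2_eq_square)
    finally show ?thesis by simp
  qed
  moreover have "sq_form n N Q" if "d = 0"
  proof -
    have "c k n = 0" if "k < N" for k
      using \<open>d = 0\<close> that sum_nonneg_eq_0_iff[of "{..<N}" "\<lambda>k. (c k n)\<^sup>2"] by (simp add: d_def)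
    then have "Q x = (\<Sum>k<N. (lin n (c k) x)\<^sup>2)" for x
      unfolding c by (intro sum.cong) (auto simp: lin_Suc)
    then show ?thesis unfolding sq_form_def by blast
  qed
  ultimately show ?thesis using that unfolding d by blast
qed

text \<open>
  Hermite's estimate: the vector \<open>S e\<^sub>i\<close> has a lift to \<open>\<int>\<^sup>n\<^sup>+\<^sup>1\<close> on which the square contributes at most
  a quarter of the minimum \<open>d\<close>.
\<close>

lemma complete_square_lower_bound:
  fixes Q :: "(nat \<Rightarrow> int) \<Rightarrow> int"
  assumes Q: "0 < d" "\<And>x. 2 * d * Q x = 2 * (d * x n + lin n b x)\<^sup>2 + B x" "sq_form n M B"
    and min: "\<And>S. unimodular (Suc n) S \<Longrightarrow> d \<le> Q (S (unit_vec n))"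
    and S: "unimodular n S" "i < n"
  shows "d\<^sup>2 \<le> B (S (unit_vec i))"
proof -
  obtain k where k: "\<bar>2 * (lin n b (S (unit_vec i)) + d * k)\<bar> \<le> d"
    using balanced_remainder[OF Q(1)] by blast
  define x where "x = (unit_vec i)(n := k)"
  define sw where "sw = (\<lambda>y::nat \<Rightarrow> int. y(i := y n, n := y i))"
  define sh where "sh = (\<lambda>y. y(n := y n + lin n (\<lambda>j. k * unit_vec i j) y))"
  \<comment> \<open>The swap sends the last unit vector to \<open>unit_vec i\<close>, the shear puts
    \<open>k\<close> into entry \<open>n\<close>, and \<open>S\<close> leaves that entry alone. So
    the lift is an admissible image of the last unit vector and minimality applies to it.\<close>
  have "unimodular (Suc n) (\<lambda>y. S (sh (sw y)))"
    unfolding sw_def sh_def using S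
    by (intro unimodular_comp[OF unimodular_Suc[OF S(1)]]
        unimodular_comp[OF unimodular_shear] unimodular_swap) auto
  from min[OF this] have "d \<le> Q (S (sh (sw (unit_vec n))))" .
  also have "sw (unit_vec n) = unit_vec i"
    using S(2) by (auto simp: unit_vec_def sw_def)
  also have "sh (unit_vec i) = x"
    using S(2) by (simp add: sh_def x_def lin_unit_vec) (simp add: unit_vec_def)
  finally have "d \<le> Q (S x)" .
  then have "2 * d * d \<le> 2 * d * Q (S x)" using Q(1) by simp
  also have "\<dots> = 2 * (d * S x n + lin n b (S x))\<^sup>2 + B (S x)" by (rule Q(2))
  also have "S x n = k" using S(1) unfolding unimodular_def by (simp add: x_def)
  also have "lin n b (S x) = lin n b (S (unit_vec i))"
    using unimodular_pullback[OF S(1), of b] by (metis lin_upd x_def)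
  also have "B (S x) = B (S (unit_vec i))"
    using sq_form_upd[OF sq_form_pullback[OF Q(3) unimodular_pullback[OF S(1)]]] unfolding x_def by blast
  finally have *: "2 * d * d \<le> 2 * (d * k + lin n b (S (unit_vec i)))\<^sup>2 + B (S (unit_vec i))" .
  \<comment> \<open>The square is at most a quarter of \<open>d\<^sup>2\<close>, so \<open>B\<close>
    is at least three halves of \<open>d\<^sup>2\<close>; the weaker bound \<open>d\<^sup>2\<close>
    is kept.\<close>
  have "(2 * (lin n b (S (unit_vec i)) + d * k))\<^sup>2 \<le> d\<^sup>2"
    using power_mono[OF k, of 2] by simp
  moreover have "(2 * (u + v))\<^sup>2 = 4 * (v + u)\<^sup>2" for u v :: int
    by (simp add: power2_eq_square algebra_simps)
  ultimately have "4 * (d * k + lin n b (S (unit_vec i)))\<^sup>2 \<le> d\<^sup>2" by simp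
  moreover have "0 \<le> d\<^sup>2" "2 * d * d = 2 * d\<^sup>2" by (simp_all add: power2_eq_square)
  ultimately show ?thesis using * by linarith
qed

text \<open>
  Here \<open>d\<close> ranges over the lower bounds for the diagonal coefficients in the unimodular class of
  \<open>Q\<close>. The slack \<open>\<epsilon> d (x\<^sub>0\<^sup>2 + \<dots> + x\<^sub>n\<^sub>-\<^sub>1\<^sup>2)\<close> is needed for the induction: in the step it absorbs the
  error of approximating \<open>x\<^sub>n + \<mu> x\<close> by finitely many rational forms.
\<close>

lemma reduction:
  "\<exists>F \<epsilon>. finite F \<and> 0 < \<epsilon> \<and> (\<forall>N Q. sq_form n N Q \<longrightarrow> (\<exists>T. unimodular n T \<and>
     (\<forall>d::int. 0 \<le> d \<longrightarrow> (\<forall>S i. unimodular n S \<longrightarrow> i < n \<longrightarrow> d \<le> Q (S (unit_vec i))) \<longrightarrow>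
        cone n F (\<lambda>x. of_int (Q (T x)) - \<epsilon> * of_int d * (\<Sum>i<n. (of_int (x i))\<^sup>2)))))"
proof (induction n)
  case 0
  have "cone 0 {} (\<lambda>x. of_int (Q x))" if "sq_form 0 N Q" for N Q
    using that unfolding sq_form_def cone_def by (auto simp: lin_def)
  then show ?case
    by (intro exI[of _ "{}"] exI[of _ 1]) (auto intro!: exI[of _ "\<lambda>x. x"] simp: unimodular_id)
next
  case (Suc n)
  obtain F \<epsilon> where F: "finite F" "0 < (\<epsilon>::real)" and IH: "\<And>N Q. sq_form n N Q \<Longrightarrow> \<exists>T. unimodular n T \<and>
     (\<forall>d::int. 0 \<le> d \<longrightarrow> (\<forall>S i. unimodular n S \<longrightarrow> i < n \<longrightarrow> d \<le> Q (S (unit_vec i))) \<longrightarrow>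
        cone n F (\<lambda>x. of_int (Q (T x)) - \<epsilon> * of_int d * (\<Sum>i<n. (of_int (x i))\<^sup>2)))"
    using Suc.IH by blast
  \<comment> \<open>The slack of \<open>B\<close> will be \<open>\<epsilon> * d0\<^sup>2\<close>.
    Completing the square divides \<open>B\<close> by \<open>2 * d0\<close>, which leaves
    \<open>\<epsilon> / 2\<close> relative to \<open>d0\<close>.\<close>
  have "0 < \<epsilon> / 2" using F by simp
  then obtain G \<gamma> where G: "finite G" "0 < \<gamma>" and
    GC: "\<And>\<mu>. (\<And>j. j < n \<Longrightarrow> \<bar>\<mu> j\<bar> \<le> 1) \<Longrightarrow>
      cone (Suc n) G (\<lambda>x. (of_int (x n) + (\<Sum>j<n. \<mu> j * of_int (x j)))\<^sup>2 +
        \<epsilon> / 2 * (\<Sum>j<n. (of_int (x j))\<^sup>2) - \<gamma> * (\<Sum>j<Suc n. (of_int (x j))\<^sup>2))"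
    using cone_perturbed_square[of "\<epsilon> / 2" n thesis] by blast
  \<comment> \<open>\<open>G\<close> serves the completed square, \<open>F\<close> padded by 0
    serves the remaining variables, and the unit vectors absorb the surplus when \<open>d\<close> is
    smaller than \<open>d0\<close>.\<close>
  define H where "H = G \<union> (\<lambda>f. f(n := 0)) ` F \<union> unit_vec ` {..<Suc n}"
  have finH: "finite H" using F G by (simp add: H_def)
  have FH: "cone (Suc n) H q" if "cone n F q" for q
    using cone_transfer[of n F q H "\<lambda>f. f(n := 0)" "\<lambda>x. x" "Suc n"] that finH
    by (auto simp: H_def lin_Suc lin_upd_left)
  have GH: "cone (Suc n) H q" if "cone (Suc n) G q" for q
    using cone_mono[OF that finH] by (auto simp: H_def)
  have IH': "cone (Suc n) H (\<lambda>x. \<Sum>i<Suc n. (of_int (x i))\<^sup>2)"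
  proof (rule cone_sum)
    fix i assume "i \<in> {..<Suc n}"
    then show "cone (Suc n) H (\<lambda>x. (of_int (x i))\<^sup>2)"
      using cone_square[OF finH, of "unit_vec i" 1 "Suc n"] by (auto simp: H_def unit_vec_lin)
  qed
  have "\<exists>T. unimodular (Suc n) T \<and>
     (\<forall>d::int. 0 \<le> d \<longrightarrow> (\<forall>S i. unimodular (Suc n) S \<longrightarrow> i < Suc n \<longrightarrow> d \<le> Q (S (unit_vec i))) \<longrightarrow>
        cone (Suc n) H (\<lambda>x. of_int (Q (T x)) - \<gamma> * of_int d * (\<Sum>i<Suc n. (of_int (x i))\<^sup>2)))"
    if Q: "sq_form (Suc n) N Q" for N Q
  proof -
    obtain S0 where S0: "unimodular (Suc n) S0" and
      min: "\<And>S. unimodular (Suc n) S \<Longrightarrow> nat (Q (S0 (unit_vec n))) \<le> nat (Q (S (unit_vec n)))"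
      using ex_has_least_nat[of "unimodular (Suc n)" "\<lambda>x. x" "\<lambda>S. nat (Q (S (unit_vec n)))"]
        unimodular_id by blast
    define Q0 where "Q0 = (\<lambda>x. Q (S0 x))"
    have Q0: "sq_form (Suc n) N Q0"
      unfolding Q0_def by (intro sq_form_pullback[OF Q] unimodular_pullback[OF S0])
    define d0 where "d0 = Q0 (unit_vec n)"
    have d0: "0 \<le> d0" unfolding d0_def using Q0 by (rule sq_form_nonneg)
    have min0: "d0 \<le> Q0 (S (unit_vec n))" if "unimodular (Suc n) S" for S
      using min[OF unimodular_comp[OF S0 that]] sq_form_nonneg[OF Q0, of "S (unit_vec n)"]
      unfolding d0_def Q0_def by simp
    have dle: "d \<le> d0" if "\<forall>S i. unimodular (Suc n) S \<longrightarrow> i < Suc n \<longrightarrow> d \<le> Q (S (unit_vec i))" for d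
      using that[rule_format, OF S0, of n] unfolding d0_def Q0_def by simp
    obtain b M B where B: "sq_form n M B"
      "\<And>x. 2 * d0 * Q0 x = 2 * (d0 * x n + lin n b x)\<^sup>2 + B x"
      "d0 = 0 \<Longrightarrow> sq_form n N Q0"
      by (rule sq_form_complete_square[OF Q0, folded d0_def]) (rule that)
    show ?thesis
    proof (cases "d0 = 0")
      case True
      obtain T where T: "unimodular n T" and
        C: "\<And>d::int. 0 \<le> d \<Longrightarrow> (\<And>S i. unimodular n S \<Longrightarrow> i < n \<Longrightarrow> d \<le> Q0 (S (unit_vec i))) \<Longrightarrow>
          cone n F (\<lambda>x. of_int (Q0 (T x)) - \<epsilon> * of_int d * (\<Sum>i<n. (of_int (x i))\<^sup>2))"
        using IH[OF B(3)[OF True]] by blast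
      \<comment> \<open>Here \<open>Q0\<close> does not involve \<open>x n\<close>, and every
        admissible \<open>d\<close> satisfies \<open>0 \<le> d \<le> d0 = 0\<close>, so no slack has
        to be provided.\<close>
      have "cone n F (\<lambda>x. of_int (Q0 (T x)))"
        using C[of 0] sq_form_nonneg[OF Q0] by simp
      then have "cone (Suc n) H (\<lambda>x. of_int (Q (S0 (T x))))"
        using FH unfolding Q0_def by blast
      then have "cone (Suc n) H (\<lambda>x. of_int (Q (S0 (T x))) - \<gamma> * of_int d * (\<Sum>i<Suc n. (of_int (x i))\<^sup>2))"
        if "0 \<le> d" "\<forall>S i. unimodular (Suc n) S \<longrightarrow> i < Suc n \<longrightarrow> d \<le> Q (S (unit_vec i))" for d
        using dle[OF that(2)] that(1) True by simp
      then show ?thesis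
        using unimodular_comp[OF S0 unimodular_Suc[OF T]] by blast
    next
      case False
      then have dpos: "0 < d0" using d0 by simp
      have lower: "d0\<^sup>2 \<le> B (S (unit_vec i))" if "unimodular n S" "i < n" for S i
        by (rule complete_square_lower_bound[where Q = Q0 and b = b and n = n and M = M, OF dpos])
          (use B min0 that in blast)+
      obtain T where T: "unimodular n T" and
        C: "\<And>d::int. 0 \<le> d \<Longrightarrow> (\<And>S i. unimodular n S \<Longrightarrow> i < n \<Longrightarrow> d \<le> B (S (unit_vec i))) \<Longrightarrow>
          cone n F (\<lambda>x. of_int (B (T x)) - \<epsilon> * of_int d * (\<Sum>i<n. (of_int (x i))\<^sup>2))"
        using IH[OF B(1)] by blast
      have CB: "cone n F (\<lambda>x. of_int (B (T x)) - \<epsilon> * of_int (d0\<^sup>2) * (\<Sum>i<n. (of_int (x i))\<^sup>2))"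
        by (rule C) (use lower in auto)
      obtain b' where b': "\<And>x. lin n b (T x) = lin n b' x" using unimodular_pullback[OF T] by blast
      \<comment> \<open>A shear of \<open>x n\<close> by \<open>k\<close> reduces the linear
        coefficients modulo \<open>d0\<close>, which brings every \<open>\<mu> j\<close> into the
        range required by \<open>GC\<close>.\<close>
      have "\<forall>j. \<exists>k. \<bar>2 * (b' j + d0 * k)\<bar> \<le> d0" using balanced_remainder[OF dpos] by metis
      then obtain k where k: "\<And>j. \<bar>2 * (b' j + d0 * k j)\<bar> \<le> d0" by metis
      define \<mu> where "\<mu> = (\<lambda>j. real_of_int (b' j + d0 * k j) / d0)"
      have le_abs2: "\<bar>y\<bar> \<le> d" if "\<bar>2 * y\<bar> \<le> d" for y d :: int using that by linarith
      have "\<bar>\<mu> j\<bar> \<le> 1" for j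
      proof -
        have "\<bar>b' j + d0 * k j\<bar> \<le> d0" using k[of j] le_abs2 by blast
        then have "real_of_int \<bar>b' j + d0 * k j\<bar> \<le> real_of_int d0" by (rule of_int_le_iff[THEN iffD2])
        then show ?thesis using dpos by (simp add: \<mu>_def)
      qed
      note C\<mu> = GH[OF GC[OF this]]
      define T1 where "T1 = (\<lambda>x. S0 (T (x(n := x n + lin n k x))))"
      have T1: "unimodular (Suc n) T1" unfolding T1_def
        using unimodular_comp[OF S0 unimodular_comp[OF unimodular_Suc[OF T] unimodular_shear]] .
      have key: "2 * d0 * Q (T1 x) = 2 * (d0 * x n + lin n (\<lambda>j. b' j + d0 * k j) x)\<^sup>2 + B (T x)" for x
      proof -
        have "T (x(n := x n + lin n k x)) n = x n + lin n k x"
          using T unfolding unimodular_def by simp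
        moreover have "B (T (x(n := x n + lin n k x))) = B (T x)"
          using sq_form_upd[OF sq_form_pullback[OF B(1) unimodular_pullback[OF T]]] .
        ultimately show ?thesis
          using B(2)[of "T (x(n := x n + lin n k x))"] unfolding Q0_def T1_def b'
          by (simp add: lin_upd lin_add_left lin_mult_left algebra_simps)
      qed
      have "cone (Suc n) H (\<lambda>x. of_int (Q (T1 x)) - \<gamma> * of_int d * (\<Sum>i<Suc n. (of_int (x i))\<^sup>2))"
        if d: "0 \<le> d" "\<forall>S i. unimodular (Suc n) S \<longrightarrow> i < Suc n \<longrightarrow> d \<le> Q (S (unit_vec i))" for d
      proof -
        define I where "I = (\<lambda>m (x::nat \<Rightarrow> int). \<Sum>i<m. (real_of_int (x i))\<^sup>2)"
        \<comment> \<open>Three summands, each in the cone: the perturbed square scaled by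
          \<open>d0\<close>, the induction hypothesis for \<open>B\<close> divided by
          \<open>2 * d0\<close>, and the surplus from \<open>d \<le> d0\<close>. The two terms with
          \<open>\<epsilon>\<close> cancel.\<close>
        have "real_of_int (Q (T1 x)) - \<gamma> * of_int d * I (Suc n) x =
           d0 * ((of_int (x n) + (\<Sum>j<n. \<mu> j * of_int (x j)))\<^sup>2 + \<epsilon> / 2 * I n x - \<gamma> * I (Suc n) x) +
           (1 / (2 * d0) * (of_int (B (T x)) - \<epsilon> * of_int (d0\<^sup>2) * I n x) +
            \<gamma> * (d0 - d) * I (Suc n) x)" for x
        proof -
          define L where "L = of_int (x n) + (\<Sum>j<n. \<mu> j * of_int (x j))"
          have "d0 * L = of_int (d0 * x n + lin n (\<lambda>j. b' j + d0 * k j) x)"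
            using dpos by (simp add: L_def \<mu>_def lin_def distrib_left sum_distrib_left)
          then have "real_of_int (2 * d0 * Q (T1 x)) = 2 * (d0 * L)\<^sup>2 + B (T x)"
            unfolding key by simp
          moreover have "q = a * l\<^sup>2 + e / (2 * a)" if "2 * a * q = 2 * (a * l)\<^sup>2 + e" "0 < a" for a q l e :: real
            using that by (simp add: field_simps power2_eq_square)
          ultimately have "real_of_int (Q (T1 x)) = d0 * L\<^sup>2 + B (T x) / (2 * d0)"
            using dpos by simp
          moreover have "1 / (2 * d0) * (of_int (B (T x)) - \<epsilon> * of_int (d0\<^sup>2) * I n x) =
              B (T x) / (2 * d0) - d0 * (\<epsilon> / 2 * I n x)"
          proof -
            have "1 / (2 * a) * (u - \<epsilon> * a\<^sup>2 * v) = u / (2 * a) - a * (\<epsilon> / 2 * v)" if "0 < a" for a u v :: real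
              using that by (simp add: field_simps power2_eq_square)
            from this[of d0] show ?thesis using dpos by simp
          qed
          ultimately show ?thesis unfolding L_def[symmetric] by (simp add: algebra_simps)
        qed
        moreover have "cone (Suc n) H (\<lambda>x. 
           d0 * ((of_int (x n) + (\<Sum>j<n. \<mu> j * of_int (x j)))\<^sup>2 + \<epsilon> / 2 * I n x - \<gamma> * I (Suc n) x) +
           (1 / (2 * d0) * (of_int (B (T x)) - \<epsilon> * of_int (d0\<^sup>2) * I n x) +
            \<gamma> * (d0 - d) * I (Suc n) x))"
          using dle[OF d(2)] dpos G(2) unfolding I_def
          by (intro cone_add cone_scale C\<mu> FH[OF CB] IH') auto
        ultimately show ?thesis unfolding I_def by simp
      qed
      then show ?thesis using T1 by blast
    qed
  qed
  then show ?case using finH G(2) by (intro exI[of _ H] exI[of _ \<gamma>]) blast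
qed

section \<open>Boundedness over the integers\<close>

text \<open>Polarization at unit vectors and their sums recovers the coefficients from the values at
  integer points. This connects forms given as functions with identities between
  coefficients.\<close>

lemma quadratic_form_coeff_eq:
  fixes v :: "'a \<Rightarrow> real" and w :: "'b \<Rightarrow> real"
  assumes eq: "\<And>x. (\<Sum>k\<in>I. v k * (of_int (lin n (c k) x))\<^sup>2) = (\<Sum>k\<in>J. w k * (of_int (lin n (d k) x))\<^sup>2)"
    and st: "s < n" "t < n"
  shows "(\<Sum>k\<in>I. v k * of_int (c k s) * of_int (c k t)) = (\<Sum>k\<in>J. w k * of_int (d k s) * of_int (d k t))"
proof -
  have polar: "2 * (\<Sum>k\<in>I. v k * of_int (c k s) * of_int (c k t)) =
      (\<Sum>k\<in>I. v k * (of_int (lin n (c k) (\<lambda>i. unit_vec s i + unit_vec t i)))\<^sup>2) -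
      (\<Sum>k\<in>I. v k * (of_int (lin n (c k) (unit_vec s)))\<^sup>2) -
      (\<Sum>k\<in>I. v k * (of_int (lin n (c k) (unit_vec t)))\<^sup>2)" for v :: "'c \<Rightarrow> real" and c I
    using st unfolding sum_distrib_left sum_subtractf[symmetric]
    by (intro sum.cong refl) (simp add: lin_add_right lin_unit_vec power2_eq_square algebra_simps)
  show ?thesis using polar[of v c I] polar[of w d J] unfolding eq by simp
qed

lemma quadratic_form_expand:
  fixes v :: "'b \<Rightarrow> 'a::comm_ring_1"
  shows "(\<Sum>k\<in>I. v k * (\<Sum>s<n. of_int (c k s) * y s)\<^sup>2) =
    (\<Sum>s<n. \<Sum>t<n. (\<Sum>k\<in>I. v k * of_int (c k s) * of_int (c k t)) * (y s * y t))"
proof -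
  have "(\<Sum>k\<in>I. v k * (\<Sum>s<n. of_int (c k s) * y s)\<^sup>2) =
      (\<Sum>k\<in>I. \<Sum>s<n. \<Sum>t<n. v k * of_int (c k s) * of_int (c k t) * (y s * y t))"
  proof (intro sum.cong refl)
    fix k
    have "v k * (\<Sum>s<n. of_int (c k s) * y s)\<^sup>2 =
        (\<Sum>s<n. \<Sum>t<n. v k * ((of_int (c k s) * y s) * (of_int (c k t) * y t)))"
      unfolding power2_eq_square sum_product by (simp only: sum_distrib_left)
    then show "v k * (\<Sum>s<n. of_int (c k s) * y s)\<^sup>2 =
        (\<Sum>s<n. \<Sum>t<n. v k * of_int (c k s) * of_int (c k t) * (y s * y t))"
      by (simp only: mult_ac)
  qed
  also have "\<dots> = (\<Sum>s<n. \<Sum>k\<in>I. \<Sum>t<n. v k * of_int (c k s) * of_int (c k t) * (y s * y t))"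
    by (rule sum.swap)
  also have "\<dots> = (\<Sum>s<n. \<Sum>t<n. \<Sum>k\<in>I. v k * of_int (c k s) * of_int (c k t) * (y s * y t))"
    by (intro sum.cong refl sum.swap)
  finally show ?thesis by (simp only: sum_distrib_right)
qed

text \<open>A version of Dickson's lemma. For one sequence of naturals, the indices whose value is
  minimal among all later ones form an infinite set, on which the sequence increases; the induction
  treats the elements of \<open>F\<close> one after another.\<close>

lemma infinite_increasing_subset:
  fixes f :: "nat \<Rightarrow> 'a \<Rightarrow> nat"
  assumes "finite F" "infinite A"
  shows "\<exists>B\<subseteq>A. infinite B \<and> (\<forall>i\<in>B. \<forall>j\<in>B. i \<le> j \<longrightarrow> (\<forall>x\<in>F. f i x \<le> f j x))"
  using assms
proof (induction F arbitrary: A rule: finite_induct)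
  case empty
  then show ?case by blast
next
  case (insert a F)
  from insert.IH[OF insert.prems]
  obtain B where B: "B \<subseteq> A" "infinite B" "\<forall>i\<in>B. \<forall>j\<in>B. i \<le> j \<longrightarrow> (\<forall>x\<in>F. f i x \<le> f j x)"
    by (elim exE conjE)
  define C where "C = {i \<in> B. \<forall>j\<in>B. i \<le> j \<longrightarrow> f i a \<le> f j a}"
  have "infinite C"
    unfolding infinite_nat_iff_unbounded_le
  proof
    fix m
    obtain j0 where "j0 \<in> B" "m \<le> j0" using B(2) infinite_nat_iff_unbounded_le by blast
    then obtain i where i: "i \<in> B \<and> m \<le> i" "\<And>j. j \<in> B \<and> m \<le> j \<Longrightarrow> f i a \<le> f j a"
      using ex_has_least_nat[of "\<lambda>i. i \<in> B \<and> m \<le> i" j0 "\<lambda>i. f i a"] by blast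
    then have "i \<in> C" unfolding C_def by auto
    then show "\<exists>i\<ge>m. i \<in> C" using i by blast
  qed
  moreover have "C \<subseteq> B" unfolding C_def by blast
  ultimately show ?case using B by (intro exI[of _ C]) (auto simp: C_def)
qed

lemma bounded_sq_form_cone:
  assumes F: "finite F"
  shows "\<exists>G. \<forall>N Q. sq_form n N Q \<longrightarrow> cone n F (\<lambda>x. of_int (Q x)) \<longrightarrow> sq_form n G Q"
proof (rule ccontr)
  assume "\<not> ?thesis"
  then have "\<forall>G. \<exists>N Q w. sq_form n N Q \<and> \<not> sq_form n G Q \<and> (\<forall>f\<in>F. (0::real) \<le> w f) \<and>
      (\<forall>x. of_int (Q x) = (\<Sum>f\<in>F. w f * (of_int (lin n f x))\<^sup>2))"
    unfolding cone_def by blast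
  then have "\<exists>N Q w. \<forall>G. sq_form n (N G) (Q G) \<and> \<not> sq_form n G (Q G) \<and> (\<forall>f\<in>F. (0::real) \<le> w G f) \<and>
      (\<forall>x. of_int (Q G x) = (\<Sum>f\<in>F. w G f * (of_int (lin n f x))\<^sup>2))"
    by (simp only: choice_iff)
  then obtain N Q w where Qw: "\<forall>G. sq_form n (N G) (Q G) \<and> \<not> sq_form n G (Q G) \<and> (\<forall>f\<in>F. (0::real) \<le> w G f) \<and>
      (\<forall>x. of_int (Q G x) = (\<Sum>f\<in>F. w G f * (of_int (lin n f x))\<^sup>2))"
    by (elim exE)
  have Q: "sq_form n (N G) (Q G)" "\<not> sq_form n G (Q G)" for G using Qw by simp_all
  have w: "\<And>f. f \<in> F \<Longrightarrow> (0::real) \<le> w G f"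
      "\<And>x. of_int (Q G x) = (\<Sum>f\<in>F. w G f * (of_int (lin n f x))\<^sup>2)" for G
    using Qw by simp_all
  have "\<forall>G. \<exists>c. \<forall>x. Q G x = (\<Sum>k<N G. (lin n (c k) x)\<^sup>2)"
    using Q(1) unfolding sq_form_def by (intro allI)
  then have "\<exists>c. \<forall>G x. Q G x = (\<Sum>k<N G. (lin n (c G k) x)\<^sup>2)" by (rule choice)
  then obtain c where c: "\<And>G x. Q G x = (\<Sum>k<N G. (lin n (c G k) x)\<^sup>2)" by auto
  define m where "m = (\<lambda>G f. nat \<lfloor>w G f\<rfloor>)"
  have m: "real (m G f) \<le> w G f" "w G f \<le> real (m G f) + 1" if "f \<in> F" for G f
    using w(1)[OF that, of G] unfolding m_def by linarith+
  \<comment> \<open>The form left after removing the integral parts of the weights. Its coefficients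
    are integers by this definition, and they are bounded because over the reals they come from the
    fractional parts alone.\<close>
  define R where "R = (\<lambda>G s t. (\<Sum>k<N G. c G k s * c G k t) - (\<Sum>f\<in>F. int (m G f) * f s * f t))"
  have R: "Q G x = (\<Sum>s<n. \<Sum>t<n. R G s t * (x s * x t)) + (\<Sum>f\<in>F. int (m G f) * (lin n f x)\<^sup>2)" for G x
    using quadratic_form_expand[where v = "\<lambda>_. 1::int" and n = n and c = "c G" and y = x and I = "{..<N G}"]
      quadratic_form_expand[where v = "\<lambda>f. int (m G f)" and n = n and c = "\<lambda>f. f" and y = x and I = F]
    unfolding c R_def lin_def by (simp add: left_diff_distrib sum_subtractf)
  define K where "K = (\<Sum>f\<in>F. \<Sum>s<n. \<Sum>t<n. \<bar>f s * f t\<bar>)"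
  have RK: "\<bar>R G s t\<bar> \<le> K" if "s < n" "t < n" for G s t
  proof -
    have "(\<Sum>k<N G. 1 * of_int (c G k s) * of_int (c G k t)) = (\<Sum>f\<in>F. w G f * of_int (f s) * of_int (f t))"
    proof (rule quadratic_form_coeff_eq[where v = "\<lambda>_. 1" and c = "c G" and d = "\<lambda>f. f" and w = "w G", OF _ that])
      fix x
      show "(\<Sum>k<N G. 1 * (real_of_int (lin n (c G k) x))\<^sup>2) = (\<Sum>f\<in>F. w G f * (of_int (lin n f x))\<^sup>2)"
        using w(2)[of G x] unfolding c by simp
    qed
    then have "real_of_int (R G s t) = (\<Sum>f\<in>F. (w G f - m G f) * of_int (f s * f t))"
      unfolding R_def by (simp add: left_diff_distrib sum_subtractf mult.assoc)
    also have "\<bar>\<dots>\<bar> \<le> (\<Sum>f\<in>F. \<bar>(w G f - m G f) * of_int (f s * f t)\<bar>)" by (rule sum_abs)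
    also have "\<dots> \<le> (\<Sum>f\<in>F. \<Sum>s<n. \<Sum>t<n. of_int \<bar>f s * f t\<bar>)"
    proof (rule sum_mono)
      fix f assume f: "f \<in> F"
      have "\<bar>(w G f - m G f) * of_int (f s * f t)\<bar> \<le> 1 * \<bar>of_int (f s * f t)\<bar>"
        unfolding abs_mult[of "w G f - m G f"] using m[OF f, of G] by (intro mult_right_mono) auto
      also have "\<dots> = real_of_int \<bar>f s * f t\<bar>" by simp
      also have "\<dots> \<le> (\<Sum>t<n. real_of_int \<bar>f s * f t\<bar>)"
        using that by (intro member_le_sum) auto
      also have "\<dots> \<le> (\<Sum>s<n. \<Sum>t<n. real_of_int \<bar>f s * f t\<bar>)"
        using that by (intro member_le_sum[of s "{..<n}" "\<lambda>s. \<Sum>t<n. real_of_int \<bar>f s * f t\<bar>"]) (auto intro: sum_nonneg)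
      finally show "\<bar>(w G f - m G f) * of_int (f s * f t)\<bar> \<le> (\<Sum>s<n. \<Sum>t<n. real_of_int \<bar>f s * f t\<bar>)" .
    qed
    also have "\<dots> = real_of_int K" unfolding K_def by simp
    finally show ?thesis by linarith
  qed
  define r where "r = (\<lambda>G. restrict (\<lambda>(s, t). R G s t) ({..<n} \<times> {..<n}))"
  have "range r \<subseteq> ({..<n} \<times> {..<n}) \<rightarrow>\<^sub>E {- K..K}"
  proof (intro image_subsetI PiE_I)
    fix G st assume "st \<in> {..<n} \<times> {..<n}"
    then obtain s t where "st = (s, t)" "s < n" "t < n" by auto
    then show "r G st \<in> {- K..K}" using RK[of s t G] by (auto simp: r_def abs_le_iff)
  qed (auto simp: r_def)
  then have "finite (range r)" by (rule finite_subset) (intro finite_PiE; simp)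
  then obtain G0 where "infinite {G \<in> UNIV. r G = r G0}"
    using pigeonhole_infinite[of UNIV r] by auto
  then obtain A where A: "A \<subseteq> {G \<in> UNIV. r G = r G0}" "infinite A"
    "\<forall>i\<in>A. \<forall>j\<in>A. i \<le> j \<longrightarrow> (\<forall>f\<in>F. m i f \<le> m j f)"
    using infinite_increasing_subset[OF F, of "{G \<in> UNIV. r G = r G0}" m] by auto
  obtain i where i: "i \<in> A" using A(2) by fastforce
  \<comment> \<open>\<open>Q j\<close> will be \<open>Q i\<close> plus \<open>4 * card F\<close>
    squares, hence a sum of \<open>N i + 4 * card F\<close> squares. Taking \<open>j\<close> at
    least this large contradicts the choice of \<open>Q j\<close> as no sum of \<open>j\<close>
    squares.\<close>
  obtain j where j: "j \<in> A" "i + N i + 4 * card F \<le> j"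
    using A(2) infinite_nat_iff_unbounded_le by blast
  have mij: "m i f \<le> m j f" if "f \<in> F" for f using A(3) i j that by auto
  have "r i = r G0" "r j = r G0" using A(1) i j(1) by blast+
  then have "r i = r j" by simp
  have "R i s t = R j s t" if "s < n" "t < n" for s t
  proof -
    have "r i (s, t) = r j (s, t)" using \<open>r i = r j\<close> by simp
    then show ?thesis using that by (simp add: r_def)
  qed
  then have "(\<Sum>s<n. \<Sum>t<n. R j s t * (x s * x t)) = (\<Sum>s<n. \<Sum>t<n. R i s t * (x s * x t))" for x
    by (intro sum.cong refl) simp
  moreover have "(\<Sum>f\<in>F. int (m j f) * (lin n f x)\<^sup>2) =
      (\<Sum>f\<in>F. int (m i f) * (lin n f x)\<^sup>2) + (\<Sum>f\<in>F. int (m j f - m i f) * (lin n f x)\<^sup>2)" for x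
    unfolding sum.distrib[symmetric] using mij by (intro sum.cong refl) (simp add: of_nat_diff left_diff_distrib)
  ultimately have "Q j x = Q i x + (\<Sum>f\<in>F. int (m j f - m i f) * (lin n f x)\<^sup>2)" for x
    unfolding R by simp
  then have "Q j = (\<lambda>x. Q i x + (\<Sum>f\<in>F. int (m j f - m i f) * (lin n f x)\<^sup>2))" by blast
  moreover have "sq_form n (N i + 4 * card F) (\<lambda>x. Q i x + (\<Sum>f\<in>F. int (m j f - m i f) * (lin n f x)\<^sup>2))"
    by (intro sq_form_add Q(1) sq_form_sum F sq_form_multiple)
  ultimately have "sq_form n (N i + 4 * card F) (Q j)" by simp
  then have "sq_form n j (Q j)" using j(2) by (rule sq_form_mono[OF _ le_trans[rotated]]) simp
  then show False using Q(2) by blast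
qed

theorem bounded_sq_form: "\<exists>G. \<forall>N Q. sq_form n N Q \<longrightarrow> sq_form n G Q"
proof -
  obtain F \<epsilon> where F: "finite F" "0 < (\<epsilon>::real)" and red: "\<And>N Q. sq_form n N Q \<Longrightarrow> \<exists>T. unimodular n T \<and>
     (\<forall>d::int. 0 \<le> d \<longrightarrow> (\<forall>S i. unimodular n S \<longrightarrow> i < n \<longrightarrow> d \<le> Q (S (unit_vec i))) \<longrightarrow>
        cone n F (\<lambda>x. of_int (Q (T x)) - \<epsilon> * of_int d * (\<Sum>i<n. (of_int (x i))\<^sup>2)))"
    using reduction[of n] by blast
  obtain G where G: "\<And>N Q. sq_form n N Q \<Longrightarrow> cone n F (\<lambda>x. of_int (Q x)) \<Longrightarrow> sq_form n G Q"
    using bounded_sq_form_cone[OF F(1)] by blast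
  have "sq_form n G Q" if Q: "sq_form n N Q" for N Q
  proof -
    obtain T where T: "unimodular n T" and
      C: "\<And>d::int. 0 \<le> d \<Longrightarrow> (\<And>S i. unimodular n S \<Longrightarrow> i < n \<Longrightarrow> d \<le> Q (S (unit_vec i))) \<Longrightarrow>
        cone n F (\<lambda>x. of_int (Q (T x)) - \<epsilon> * of_int d * (\<Sum>i<n. (of_int (x i))\<^sup>2))"
      using red[OF Q] by blast
    \<comment> \<open>The slack serves only the induction in \<open>reduction\<close>; the bound
      \<open>d = 0\<close> discards it.\<close>
    have "cone n F (\<lambda>x. of_int (Q (T x)))"
      using C[of 0] sq_form_nonneg[OF Q] by simp
    then have "sq_form n G (\<lambda>x. Q (T x))"
      using G[OF sq_form_pullback[OF Q unimodular_pullback[OF T]]] by blast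
    then have "sq_form n G (\<lambda>x. Q (T (inv T x)))"
      by (rule sq_form_pullback) (use T in \<open>auto simp: unimodular_def\<close>)
    moreover have "T (inv T x) = x" for x
    proof -
      have "bij T" using T unfolding unimodular_def by (rule conjunct1)
      then show ?thesis by (simp add: bij_is_surj surj_f_inv_f)
    qed
    ultimately show ?thesis by simp
  qed
  then show ?thesis by blast
qed

text \<open>An equality of integral quadratic forms is an equality of integer coefficients, so it
  survives evaluation at elements of any commutative ring. In the end \<open>\<theta>\<close> will
  consist of linear forms.\<close>

lemma bounded_squares_span:
  fixes \<theta> :: "'i \<Rightarrow> 'a::comm_ring_1"
  assumes "finite I"
  shows "\<exists>G. \<forall>(N::nat) c. \<exists>c'. (\<Sum>k<N. (\<Sum>t\<in>I. of_int (c k t) * \<theta> t)\<^sup>2) =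
    (\<Sum>k<G::nat. (\<Sum>t\<in>I. of_int (c' k t) * \<theta> t)\<^sup>2)"
proof -
  define n where "n = card I"
  obtain h where h: "bij_betw h {..<n} I"
    using ex_bij_betw_nat_finite[OF assms] unfolding n_def lessThan_atLeast0 by blast
  define y where "y = (\<lambda>s. \<theta> (h s))"
  obtain G where G: "\<And>N Q. sq_form n N Q \<Longrightarrow> sq_form n G Q" using bounded_sq_form by blast
  have "\<exists>c'. (\<Sum>k<N. (\<Sum>t\<in>I. of_int (c k t) * \<theta> t)\<^sup>2) = (\<Sum>k<G. (\<Sum>t\<in>I. of_int (c' k t) * \<theta> t)\<^sup>2)" for N :: nat and c
  proof -
    define d where "d = (\<lambda>k s. c k (h s))"
    have "sq_form n N (\<lambda>x. \<Sum>k<N. (lin n (d k) x)\<^sup>2)" unfolding sq_form_def by blast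
    from G[OF this]
    obtain d' where d': "\<And>x. (\<Sum>k<N. (lin n (d k) x)\<^sup>2) = (\<Sum>k<G. (lin n (d' k) x)\<^sup>2)"
      unfolding sq_form_def by blast
    have "(\<Sum>k<N. 1 * real_of_int (d k s) * of_int (d k t)) = (\<Sum>k<G. 1 * real_of_int (d' k s) * of_int (d' k t))"
      if "s < n" "t < n" for s t
    proof (rule quadratic_form_coeff_eq[where v = "\<lambda>_. 1" and w = "\<lambda>_. 1" and c = d and d = d', OF _ that])
      fix x
      have "real_of_int (\<Sum>k<N. (lin n (d k) x)\<^sup>2) = real_of_int (\<Sum>k<G. (lin n (d' k) x)\<^sup>2)"
        unfolding d' ..
      then show "(\<Sum>k<N. 1 * (real_of_int (lin n (d k) x))\<^sup>2) = (\<Sum>k<G. 1 * (real_of_int (lin n (d' k) x))\<^sup>2)"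
        by simp
    qed
    then have "real_of_int (\<Sum>k<N. d k s * d k t) = real_of_int (\<Sum>k<G. d' k s * d' k t)"
      if "s < n" "t < n" for s t using that by simp
    then have "(\<Sum>k<N. d k s * d k t) = (\<Sum>k<G. d' k s * d' k t)" if "s < n" "t < n" for s t
      using that of_int_eq_iff by blast
    then have "(of_int (\<Sum>k<N. d k s * d k t) :: 'a) = of_int (\<Sum>k<G. d' k s * d' k t)" if "s < n" "t < n" for s t
      using that by simp
    then have "(\<Sum>s<n. \<Sum>t<n. (\<Sum>k<N. 1 * of_int (d k s) * of_int (d k t)) * (y s * y t)) =
        (\<Sum>s<n. \<Sum>t<n. (\<Sum>k<G. 1 * of_int (d' k s) * of_int (d' k t)) * (y s * y t))"
      by (intro sum.cong refl) simp
    then have "(\<Sum>k<N. 1 * (\<Sum>s<n. of_int (d k s) * y s)\<^sup>2) = (\<Sum>k<G. 1 * (\<Sum>s<n. of_int (d' k s) * y s)\<^sup>2)"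
      unfolding quadratic_form_expand .
    moreover have "(\<Sum>t\<in>I. of_int (c k t) * \<theta> t) = (\<Sum>s<n. of_int (d k s) * y s)" for k
      unfolding d_def y_def using sum.reindex_bij_betw[OF h, of "\<lambda>t. of_int (c k t) * \<theta> t"] by simp
    moreover have "(\<Sum>t\<in>I. of_int (d' k (the_inv_into {..<n} h t)) * \<theta> t) = (\<Sum>s<n. of_int (d' k s) * y s)" for k
    proof -
      have "(\<Sum>t\<in>I. of_int (d' k (the_inv_into {..<n} h t)) * \<theta> t) =
          (\<Sum>s<n. of_int (d' k (the_inv_into {..<n} h (h s))) * \<theta> (h s))"
        using sum.reindex_bij_betw[OF h, of "\<lambda>t. of_int (d' k (the_inv_into {..<n} h t)) * \<theta> t"] by simp
      also have "\<dots> = (\<Sum>s<n. of_int (d' k s) * y s)"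
        using h unfolding y_def by (intro sum.cong refl) (simp add: bij_betw_def the_inv_into_f_f)
      finally show ?thesis .
    qed
    ultimately show ?thesis by (intro exI[of _ "\<lambda>k t. d' k (the_inv_into {..<n} h t)"]) simp
  qed
  then show ?thesis by blast
qed

section \<open>Orders are finitely generated\<close>

lemma unital_subring_closed:
  assumes "unital_subring R"
  shows unital_subring_0: "0 \<in> R" and unital_subring_1: "1 \<in> R"
    and unital_subring_diff: "x \<in> R \<Longrightarrow> y \<in> R \<Longrightarrow> x - y \<in> R"
    and unital_subring_mult: "x \<in> R \<Longrightarrow> y \<in> R \<Longrightarrow> x * y \<in> R"
    and unital_subring_add: "x \<in> R \<Longrightarrow> y \<in> R \<Longrightarrow> x + y \<in> R"
proof -
  show 0: "0 \<in> R" and "1 \<in> R" using assms unfolding unital_subring_def by (metis diff_self)+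
  show *: "x \<in> R \<Longrightarrow> y \<in> R \<Longrightarrow> x - y \<in> R" for x y using assms unfolding unital_subring_def by blast
  show "x \<in> R \<Longrightarrow> y \<in> R \<Longrightarrow> x * y \<in> R" using assms unfolding unital_subring_def by blast
  show "x \<in> R \<Longrightarrow> y \<in> R \<Longrightarrow> x + y \<in> R" using *[of x "0 - y"] *[OF 0, of y] by simp
qed

lemma unital_subring_sum:
  assumes "unital_subring R" "\<And>i. i \<in> I \<Longrightarrow> f i \<in> R"
  shows "(\<Sum>i\<in>I. f i) \<in> R"
  using assms(2) by (induction I rule: infinite_finite_induct)
    (auto intro: unital_subring_0 unital_subring_add assms(1))

lemma unital_subring_of_int:
  assumes "unital_subring R"
  shows "of_int k \<in> R"
proof -
  have n: "of_nat n \<in> R" for n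
    by (induction n) (use assms in \<open>auto intro: unital_subring_0 unital_subring_add unital_subring_1\<close>)
  show ?thesis
  proof (cases "0 \<le> k")
    case True
    then show ?thesis using n[of "nat k"] by simp
  next
    case False
    then have "(of_int k :: 'a) = 0 - of_nat (nat (- k))" by simp
    then show ?thesis using n unital_subring_0 unital_subring_diff assms by metis
  qed
qed

lemma unital_subring_power: "unital_subring R \<Longrightarrow> x \<in> R \<Longrightarrow> x ^ k \<in> R"
  by (induction k) (auto intro: unital_subring_1 unital_subring_mult)

section \<open>Bounded denominators and discreteness\<close>

lemma common_denominator:
  fixes S :: "rat set"
  assumes "finite S"
  shows "\<exists>D::int. D > 0 \<and> (\<forall>q\<in>S. of_int D * q \<in> \<int>)"
  using assms
proof (induction S rule: finite_induct)
  case (insert q S)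
  then obtain D where D: "D > 0" "\<forall>q\<in>S. of_int D * q \<in> \<int>" by blast
  obtain a b where ab: "q = of_int a / of_int b" "b > 0"
    by (metis quotient_of_div quotient_of_denom_pos surj_pair)
  have "of_int (D * b) * q = of_int (D * a)" using ab by simp
  then have "of_int (D * b) * q \<in> \<int>" by (metis Ints_of_int)
  moreover have "of_int (D * b) * p \<in> \<int>" if "p \<in> S" for p
  proof -
    have "of_int (D * b) * p = of_int b * (of_int D * p)" by simp
    also have "\<dots> \<in> \<int>" by (rule Ints_mult[OF Ints_of_int]) (use D(2) that in blast)
    finally show ?thesis .
  qed
  ultimately show ?case using D(1) ab(2) by (intro exI[of _ "D * b"]) auto
qed (auto intro: exI[of _ 1])

text \<open>A monic relation of degree \<open>m\<close> makes each power from \<open>x ^ m\<close>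
  on an integral combination of the \<open>m\<close> preceding ones, so a common denominator for the
  first \<open>m\<close> powers serves all. Additivity of \<open>\<phi>\<close> is asked only on
  combinations of powers, as coordinate functions are linear only on the span.\<close>

lemma algebraic_int_power_bounded_denominator:
  fixes x :: "'a::field_char_0" and \<phi> :: "'a \<Rightarrow> rat"
  assumes x: "algebraic_int x"
    and \<phi>: "\<And>k N (a::nat \<Rightarrow> int). \<phi> (\<Sum>i<N. of_int (a i) * x ^ (k + i)) = (\<Sum>i<N. of_int (a i) * \<phi> (x ^ (k + i)))"
  shows "\<exists>D::int. D > 0 \<and> (\<forall>k. of_int D * \<phi> (x ^ k) \<in> \<int>)"
proof -
  obtain p where p: "poly (map_poly of_int p) x = 0" "lead_coeff p = 1"
    using x unfolding algebraic_int_altdef_ipoly by blast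
  define m where "m = degree p"
  have "poly (map_poly of_int p) x = (\<Sum>i\<le>m. of_int (coeff p i) * x ^ i)"
    by (simp add: poly_altdef m_def coeff_map_poly degree_map_poly)
  also have "\<dots> = x ^ m + (\<Sum>i<m. of_int (coeff p i) * x ^ i)"
    using p(2) by (simp add: lessThan_Suc_atMost[symmetric] m_def)
  finally have xm: "x ^ m = (\<Sum>i<m. of_int (- coeff p i) * x ^ i)"
    using p(1) by (simp add: sum_negf eq_neg_iff_add_eq_0)
  obtain D :: int where D: "D > 0" "\<forall>q\<in>(\<lambda>i. \<phi> (x ^ i)) ` {..<m}. of_int D * q \<in> \<int>"
    using common_denominator[of "(\<lambda>i. \<phi> (x ^ i)) ` {..<m}"] by auto
  have "of_int D * \<phi> (x ^ k) \<in> \<int>" for k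
  proof (induction k rule: less_induct)
    case (less k)
    show ?case
    proof (cases "k < m")
      case False
      then have "x ^ k = x ^ (k - m) * x ^ m" by (simp flip: power_add)
      also have "\<dots> = (\<Sum>i<m. of_int (- coeff p i) * x ^ (k - m + i))"
        unfolding xm by (simp add: sum_distrib_left power_add algebra_simps)
      finally have "of_int D * \<phi> (x ^ k) = (\<Sum>i<m. of_int (- coeff p i) * (of_int D * \<phi> (x ^ (k - m + i))))"
        unfolding \<phi> by (simp only: \<phi> sum_distrib_left mult.left_commute)
      also have "\<dots> \<in> \<int>"
        using False by (intro Ints_sum Ints_mult Ints_of_int less) auto
      finally show ?thesis .
    qed (use D in auto)
  qed
  then show ?thesis using D(1) by blast
qed

lemma Ints_abs_less_1_eq_0:
  fixes q :: rat
  assumes "q \<in> \<int>" "\<bar>q\<bar> < 1"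
  shows "q = 0"
proof -
  obtain k where k: "q = of_int k" using assms(1) by (rule Ints_cases)
  then have "\<bar>k\<bar> < 1" using assms(2) by (metis of_int_abs of_int_less_1_iff)
  then show ?thesis using k by simp
qed

text \<open>Discreteness leaves finitely many elements of \<open>R\<close> in the half-open unit box
  of a rational basis chosen inside \<open>R\<close>. Subtracting the floors of the coordinates
  moves any element into the box, so basis and box together generate.\<close>

theorem integral_subring_finitely_generated:
  fixes R :: "'a::field_char_0 set"
  assumes R: "unital_subring R" "\<And>x. x \<in> R \<Longrightarrow> algebraic_int x"
    and fin: "finite B0" "R \<subseteq> rat_space.span B0"
  shows "\<exists>S\<subseteq>R. finite S \<and> (\<forall>x\<in>R. \<exists>c. x = (\<Sum>s\<in>S. of_int (c s) * s))"
proof -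
  obtain B where B: "B \<subseteq> R" "rat_space.independent B" "R \<subseteq> rat_space.span B"
    using rat_space.maximal_independent_subset[of R] by blast
  have finB: "finite B"
    using rat_space.independent_span_bound[OF fin(1) B(2)] B(1) fin(2) by blast
  define r where "r = rat_space.representation B"
  let ?V = "rat_space.span B"
  have RV: "x \<in> ?V" if "x \<in> R" for x using that B(3) by blast
  have r_expand: "(\<Sum>b\<in>B. of_rat (r x b) * b) = x" if "x \<in> ?V" for x
    unfolding r_def by (rule rat_space.sum_representation_eq[OF B(2) that finB]) simp
  have r_diff: "r (x - y) b = r x b - r y b" if "x \<in> ?V" "y \<in> ?V" for x y b
    unfolding r_def using rat_space.representation_diff[OF B(2) that(2,1)] by simp
  have r_scale: "r (of_rat q * x) b = q * r x b" if "x \<in> ?V" for x q b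
    unfolding r_def using rat_space.representation_scale[OF B(2) that] by simp
  have r_sum: "r (\<Sum>i\<in>I. f i) b = (\<Sum>i\<in>I. r (f i) b)" if "\<And>i. i \<in> I \<Longrightarrow> f i \<in> ?V" for I b and f :: "'i \<Rightarrow> 'a"
    unfolding r_def using rat_space.representation_sum[of B I f, OF B(2) that] by simp
  have r_basis: "r b' b = (if b = b' then 1 else 0)" if "b' \<in> B" for b b'
    unfolding r_def using rat_space.representation_basis[OF B(2) that] by simp

  define nm where "nm = (\<lambda>x. \<Sum>b\<in>B. \<bar>r x b\<bar>)"
  have nm0: "0 \<le> nm x" for x by (simp add: nm_def sum_nonneg)
  have nm_sum: "nm (\<Sum>i\<in>I. of_rat (q i) * f i) \<le> (\<Sum>i\<in>I. \<bar>q i\<bar> * nm (f i))"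
    if "\<And>i. i \<in> I \<Longrightarrow> f i \<in> ?V" for I q and f :: "'i \<Rightarrow> 'a"
  proof -
    have "nm (\<Sum>i\<in>I. of_rat (q i) * f i) = (\<Sum>b\<in>B. \<bar>\<Sum>i\<in>I. q i * r (f i) b\<bar>)"
      unfolding nm_def using that by (simp add: r_sum r_scale rat_space.span_scale)
    also have "\<dots> \<le> (\<Sum>b\<in>B. \<Sum>i\<in>I. \<bar>q i\<bar> * \<bar>r (f i) b\<bar>)"
      by (intro sum_mono order_trans[OF sum_abs]) (simp add: abs_mult)
    also have "\<dots> = (\<Sum>i\<in>I. \<bar>q i\<bar> * nm (f i))"
      unfolding nm_def sum_distrib_left by (rule sum.swap)
    finally show ?thesis .
  qed
  \<comment> \<open>A bound from the multiplication table of the basis. It makes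
    \<open>C * nm x\<close> submultiplicative; the summand 1 ensures
    \<open>nm x \<le> C * nm x\<close>.\<close>
  define C where "C = 1 + (\<Sum>(b, b')\<in>B\<times>B. nm (b * b'))"
  have C1: "1 \<le> C" unfolding C_def by (auto intro: sum_nonneg nm0)
  have nm_mult: "nm (x * y) \<le> C * nm x * nm y" if "x \<in> ?V" "y \<in> ?V" for x y
  proof -
    have "x * y = (\<Sum>b\<in>B. of_rat (r x b) * b) * (\<Sum>b\<in>B. of_rat (r y b) * b)"
      using r_expand that by simp
    also have "\<dots> = (\<Sum>p\<in>B\<times>B. of_rat (r x (fst p) * r y (snd p)) * (fst p * snd p))"
      unfolding sum_product sum.cartesian_product
      by (intro sum.cong refl) (auto simp: of_rat_mult algebra_simps)
    finally have xy: "x * y = (\<Sum>p\<in>B\<times>B. of_rat (r x (fst p) * r y (snd p)) * (fst p * snd p))" .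
    have "nm (x * y) \<le> (\<Sum>p\<in>B\<times>B. \<bar>r x (fst p) * r y (snd p)\<bar> * nm (fst p * snd p))"
      unfolding xy
    proof (rule nm_sum)
      fix p assume "p \<in> B \<times> B"
      then have "fst p * snd p \<in> R" using B(1) by (intro unital_subring_mult[OF R(1)]) auto
      then show "fst p * snd p \<in> ?V" by (rule RV)
    qed
    also have "\<dots> \<le> (\<Sum>p\<in>B\<times>B. \<bar>r x (fst p) * r y (snd p)\<bar> * C)"
    proof (intro sum_mono mult_left_mono)
      fix p assume "p \<in> B \<times> B"
      then have "nm (fst p * snd p) \<le> (\<Sum>p\<in>B\<times>B. nm (fst p * snd p))"
        using finB by (intro member_le_sum) (auto simp: nm0)
      then show "nm (fst p * snd p) \<le> C" unfolding C_def by (simp add: case_prod_beta)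
    qed simp
    also have "\<dots> = C * nm x * nm y"
      unfolding nm_def mult.assoc sum_product sum.cartesian_product
      by (simp add: sum_distrib_left abs_mult case_prod_beta algebra_simps)
    finally show ?thesis .
  qed

  have discrete: "x = 0" if x: "x \<in> R" "2 * C * nm x \<le> 1" for x
  proof -
    have pw: "C * nm (x ^ Suc k) \<le> (1 / 2) ^ Suc k" for k
    proof (induction k)
      case (Suc k)
      have "C * nm (x ^ Suc (Suc k)) \<le> C * (C * nm x * nm (x ^ Suc k))"
        using nm_mult[OF RV[OF x(1)] RV[OF unital_subring_power[OF R(1) x(1)]], of "Suc k"] C1
        by (intro mult_left_mono) auto
      also have "\<dots> = (C * nm x) * (C * nm (x ^ Suc k))" by simp
      also have "\<dots> \<le> (1 / 2) * (1 / 2) ^ Suc k"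
        using x(2) C1 nm0 Suc by (intro mult_mono) auto
      finally show ?case by simp
    qed (use x(2) in simp)
    have "\<exists>D::int. D > 0 \<and> (\<forall>k. of_int D * r (x ^ k) b \<in> \<int>)" for b
    proof (rule algebraic_int_power_bounded_denominator[OF R(2)[OF x(1)]])
      fix k N and a :: "nat \<Rightarrow> int"
      have V: "x ^ i \<in> ?V" for i using unital_subring_power[OF R(1) x(1)] RV by blast
      have "of_int (a i) * x ^ (k + i) = of_rat (of_int (a i)) * x ^ (k + i)" for i by simp
      then show "r (\<Sum>i<N. of_int (a i) * x ^ (k + i)) b = (\<Sum>i<N. of_int (a i) * r (x ^ (k + i)) b)"
        using V by (simp only: r_sum r_scale rat_space.span_scale)
    qed
    then obtain D where D: "\<And>b. (D b::int) > 0" "\<And>b k. of_int (D b) * r (x ^ k) b \<in> \<int>" by metis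
    \<comment> \<open>The denominators depend on the coordinate, but \<open>B\<close> is finite, so
      one exponent beats all of them.\<close>
    have "\<exists>k. \<forall>b\<in>B. of_int (D b) * (1 / 2) ^ Suc k < (1::rat)"
    proof -
      define M where "M = (\<Sum>b\<in>B. D b)"
      obtain k where k: "rat_of_int M < 2 ^ k"
        using reals_Archimedean2[of "rat_of_int M"] of_nat_less_two_power by (metis less_trans)
      have "of_int (D b) * (1 / 2) ^ Suc k < (1::rat)" if "b \<in> B" for b
      proof -
        have "D b \<le> M" unfolding M_def using that finB D(1) by (intro member_le_sum) (auto intro: less_imp_le)
        then have "rat_of_int (D b) \<le> rat_of_int M" by simp
        also note k
        also have "(2::rat) ^ k \<le> 2 * 2 ^ k" by simp
        finally have "rat_of_int (D b) < 2 * 2 ^ k" .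
        then show ?thesis by (simp add: field_simps)
      qed
      then show ?thesis by blast
    qed
    then obtain k where k: "\<And>b. b \<in> B \<Longrightarrow> of_int (D b) * (1 / 2) ^ Suc k < (1::rat)" by blast
    have "r (x ^ Suc k) b = 0" if b: "b \<in> B" for b
    proof -
      have "\<bar>r (x ^ Suc k) b\<bar> \<le> nm (x ^ Suc k)"
        unfolding nm_def using finB b by (intro member_le_sum) auto
      also have "\<dots> \<le> C * nm (x ^ Suc k)" using C1 nm0 by (simp add: mult_right_mono[of 1 C, simplified])
      also have "\<dots> \<le> (1 / 2) ^ Suc k" by (rule pw)
      finally have "of_int (D b) * \<bar>r (x ^ Suc k) b\<bar> \<le> of_int (D b) * (1 / 2) ^ Suc k"
        using D(1)[of b] by (intro mult_left_mono) auto
      also have "\<dots> < 1" by (rule k[OF b])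
      finally have "\<bar>of_int (D b) * r (x ^ Suc k) b\<bar> < 1"
        using D(1)[of b] by (simp add: abs_mult)
      from Ints_abs_less_1_eq_0[OF D(2) this] show ?thesis using D(1)[of b] by simp
    qed
    then have "x ^ Suc k = 0"
      using r_expand[OF RV[OF unital_subring_power[OF R(1) x(1)]], of "Suc k"] by simp
    then show ?thesis by (rule power_eq_0_iff[THEN iffD1, THEN conjunct1])
  qed

  define Box where "Box = {x \<in> R. \<forall>b\<in>B. 0 \<le> r x b \<and> r x b < 1}"
  have "finite Box"
  proof -
    \<comment> \<open>Elements in the same cell of side \<open>1 / N\<close> differ by an element of
      \<open>R\<close> of norm at most \<open>card B / N\<close>. This choice of \<open>N\<close>
      brings it below \<open>1 / (2 * C)\<close>, where \<open>discrete\<close> applies.\<close>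
    obtain N :: nat where N: "2 * C * of_nat (card B) < of_nat N"
      using reals_Archimedean2 by blast
    moreover have "0 \<le> 2 * C * of_nat (card B)" using C1 by simp
    ultimately have "0 < rat_of_nat N" by (rule le_less_trans[rotated])
    then have N0: "0 < N" by simp
    define \<beta> where "\<beta> = (\<lambda>x. restrict (\<lambda>b. \<lfloor>of_nat N * r x b\<rfloor>) B)"
    have "\<beta> ` Box \<subseteq> B \<rightarrow>\<^sub>E {0..<int N}"
    proof -
      have "0 \<le> \<lfloor>of_nat N * r x b\<rfloor> \<and> \<lfloor>of_nat N * r x b\<rfloor> < int N" if "x \<in> Box" "b \<in> B" for x b
        using that N0 by (auto simp: Box_def floor_less_iff)
      then show ?thesis by (auto simp: \<beta>_def)
    qed
    moreover have "inj_on \<beta> Box"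
    proof (rule inj_onI)
      fix x y assume xy: "x \<in> Box" "y \<in> Box" "\<beta> x = \<beta> y"
      then have R': "x \<in> R" "y \<in> R" by (auto simp: Box_def)
      have "\<bar>r (x - y) b\<bar> \<le> 1 / of_nat N" if "b \<in> B" for b
      proof -
        have "\<lfloor>of_nat N * r x b\<rfloor> = \<lfloor>of_nat N * r y b\<rfloor>"
          using fun_cong[OF xy(3), of b] that by (simp add: \<beta>_def)
        then have "\<bar>of_nat N * r x b - of_nat N * r y b\<bar> < 1" by linarith
        then have "of_nat N * \<bar>r (x - y) b\<bar> < 1"
          using N0 R' RV by (simp add: r_diff abs_mult flip: right_diff_distrib)
        then show ?thesis using N0 by (simp add: field_simps)
      qed
      then have "nm (x - y) \<le> of_nat (card B) * (1 / of_nat N)"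
        unfolding nm_def by (rule sum_bounded_above)
      then have "2 * C * nm (x - y) \<le> 2 * C * (of_nat (card B) * (1 / of_nat N))"
        using C1 by (intro mult_left_mono) auto
      also have "\<dots> \<le> 1" using N N0 by (simp add: field_simps)
      finally have "x - y = 0"
        using discrete unital_subring_diff[OF R(1) R'] by blast
      then show "x = y" by simp
    qed
    moreover have "finite (B \<rightarrow>\<^sub>E {0..<int N})" using finB by (intro finite_PiE) auto
    ultimately show ?thesis using inj_on_finite by blast
  qed

  have "\<exists>c. x = (\<Sum>s\<in>B \<union> Box. of_int (c s) * s)" if x: "x \<in> R" for x
  proof -
    define z where "z = (\<Sum>b\<in>B. of_int \<lfloor>r x b\<rfloor> * b)"
    define y where "y = x - z"
    have zR: "z \<in> R" unfolding z_def using B(1) R(1)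
      by (intro unital_subring_sum unital_subring_mult unital_subring_of_int) auto
    have rz: "r z b = of_int \<lfloor>r x b\<rfloor>" if "b \<in> B" for b
    proof -
      have "z = (\<Sum>b\<in>B. of_rat (of_int \<lfloor>r x b\<rfloor>) * b)" by (simp add: z_def)
      then have "r z b = (\<Sum>b'\<in>B. of_int \<lfloor>r x b'\<rfloor> * r b' b)"
        using r_scale[OF rat_space.span_base]
        by (simp only: r_sum rat_space.span_scale rat_space.span_base cong: sum.cong)
      also have "\<dots> = (\<Sum>b'\<in>B. if b' = b then of_int \<lfloor>r x b'\<rfloor> else 0)"
        by (intro sum.cong) (auto simp: r_basis)
      finally show ?thesis using finB that by simp
    qed
    have "y \<in> Box"
      unfolding Box_def
    proof (intro CollectI conjI ballI)
      show "y \<in> R" unfolding y_def using R(1) x zR by (rule unital_subring_diff)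
      fix b assume "b \<in> B"
      then have "r y b = r x b - of_int \<lfloor>r x b\<rfloor>"
        unfolding y_def using r_diff RV x zR rz by simp
      then show "0 \<le> r y b" "r y b < 1" by linarith+
    qed
    define c where "c = (\<lambda>s. (if s \<in> B then \<lfloor>r x s\<rfloor> else 0) + (if s = y then 1 else 0))"
    have "(\<Sum>s\<in>B \<union> Box. of_int (c s) * s) =
        (\<Sum>s\<in>B \<union> Box. if s \<in> B then of_int \<lfloor>r x s\<rfloor> * s else 0) + (\<Sum>s\<in>B \<union> Box. if s = y then s else 0)"
      unfolding sum.distrib[symmetric] by (intro sum.cong) (auto simp: c_def distrib_right)
    also have "(\<Sum>s\<in>B \<union> Box. if s \<in> B then of_int \<lfloor>r x s\<rfloor> * s else 0) = z"
      unfolding z_def using finB \<open>finite Box\<close> by (intro sum.mono_neutral_cong_right) auto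
    also have "(\<Sum>s\<in>B \<union> Box. if s = y then s else 0) = y"
      using finB \<open>finite Box\<close> \<open>y \<in> Box\<close> by simp
    finally show ?thesis unfolding y_def by (intro exI[of _ c]) simp
  qed
  then show ?thesis using finB \<open>finite Box\<close> B(1) unfolding Box_def
    by (intro exI[of _ "B \<union> Box"]) (auto simp: Box_def)
qed

section \<open>Linear forms over an order\<close>

definition linear_monomial :: "nat \<Rightarrow> 'a::comm_ring_1 \<Rightarrow> 'a mpolynomial" where
  "linear_monomial i a = Poly_Mapping.single (Poly_Mapping.single i 1) a"

lemma linear_monomial_scale: "of_int k * linear_monomial i a = linear_monomial i (of_int k * a)"
proof -
  have "of_int k * linear_monomial i a = Poly_Mapping.single 0 (of_int k) * linear_monomial i a"
    by simp
  also have "\<dots> = linear_monomial i (of_int k * a)"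
    unfolding linear_monomial_def by (simp only: mult_single add_0_left)
  finally show ?thesis .
qed

lemma linear_monomial_sum: "(\<Sum>j\<in>J. linear_monomial i (f j)) = linear_monomial i (\<Sum>j\<in>J. f j)"
  unfolding linear_monomial_def
  by (induction J rule: infinite_finite_induct) (auto simp: single_add)

lemma lookup_sum_linear_monomials:
  "Poly_Mapping.lookup (\<Sum>i\<in>I. linear_monomial i (a i)) m =
    (\<Sum>i\<in>I. if m = Poly_Mapping.single i 1 then a i else 0)"
  unfolding linear_monomial_def lookup_sum
  by (intro sum.cong refl) (auto simp: lookup_single when_def)

lemma monomial_degree_1:
  assumes "monomial_degree m = 1"
  obtains i where "m = Poly_Mapping.single i 1"
proof -
  obtain i where i: "Poly_Mapping.keys m = {i}" "Poly_Mapping.lookup m i = 1"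
    using assms sum_eq_1_iff[of "Poly_Mapping.keys m" "Poly_Mapping.lookup m"]
    unfolding monomial_degree_def by (fastforce simp: in_keys_iff)
  then have "m = Poly_Mapping.single i 1"
    by (intro poly_mapping_eqI) (metis in_keys_iff lookup_single_eq lookup_single_not_eq singletonD)
  then show ?thesis using that by blast
qed

text \<open>A monomial of degree 1 is a single variable, so a linear form is the same as a tuple of
  \<open>r\<close> coefficients in \<open>R\<close>.\<close>

lemma linear_forms_eq:
  assumes R: "unital_subring R"
  shows "p \<in> forms R r 1 \<longleftrightarrow> (\<exists>a. (\<forall>i\<in>{1..r}. a i \<in> R) \<and> p = (\<Sum>i=1..r. linear_monomial i (a i)))"
proof
  assume p: "p \<in> forms R r 1"
  have "p = (\<Sum>i=1..r. linear_monomial i (Poly_Mapping.lookup p (Poly_Mapping.single i 1)))"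
  proof (rule poly_mapping_eqI)
    fix m
    have inj: "i = j" if "Poly_Mapping.single i (1::nat) = Poly_Mapping.single j 1" for i j :: nat
      using that by (metis lookup_single_eq lookup_single_not_eq zero_neq_one)
    show "Poly_Mapping.lookup p m = Poly_Mapping.lookup (\<Sum>i=1..r. linear_monomial i (Poly_Mapping.lookup p (Poly_Mapping.single i 1))) m"
    proof (cases "\<exists>i\<in>{1..r}. m = Poly_Mapping.single i 1")
      case True
      then obtain i where i: "i \<in> {1..r}" "m = Poly_Mapping.single i 1" by blast
      have "(\<Sum>j=1..r. if m = Poly_Mapping.single j 1 then Poly_Mapping.lookup p (Poly_Mapping.single j 1) else 0) =
          (\<Sum>j=1..r. if j = i then Poly_Mapping.lookup p m else 0)"
        using i inj by (intro sum.cong refl) auto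
      then show ?thesis using i(1) unfolding lookup_sum_linear_monomials by simp
    next
      case False
      have "m \<notin> Poly_Mapping.keys p"
      proof
        assume "m \<in> Poly_Mapping.keys p"
        then have "Poly_Mapping.keys m \<subseteq> {1..r}" "monomial_degree m = 1" using p unfolding forms_def by auto
        then show False using False by (elim monomial_degree_1) auto
      qed
      moreover have "(\<Sum>j=1..r. if m = Poly_Mapping.single j 1 then Poly_Mapping.lookup p (Poly_Mapping.single j 1) else 0) = 0"
        using False by (intro sum.neutral) auto
      ultimately show ?thesis unfolding lookup_sum_linear_monomials by (simp add: in_keys_iff)
    qed
  qed
  moreover have "Poly_Mapping.lookup p m \<in> R" for m using p unfolding forms_def by blast
  ultimately show "\<exists>a. (\<forall>i\<in>{1..r}. a i \<in> R) \<and> p = (\<Sum>i=1..r. linear_monomial i (a i))"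
    by (intro exI[of _ "\<lambda>i. Poly_Mapping.lookup p (Poly_Mapping.single i 1)"] conjI ballI)
next
  assume "\<exists>a. (\<forall>i\<in>{1..r}. a i \<in> R) \<and> p = (\<Sum>i=1..r. linear_monomial i (a i))"
  then obtain a where a: "\<forall>i\<in>{1..r}. a i \<in> R" "p = (\<Sum>i=1..r. linear_monomial i (a i))"
    by (elim exE conjE) (rule that)
  have "Poly_Mapping.lookup p m \<in> R" for m
    unfolding a(2) lookup_sum_linear_monomials using a(1) R
    by (intro unital_subring_sum) (auto intro: unital_subring_0)
  moreover have "Poly_Mapping.keys m \<subseteq> {1..r} \<and> monomial_degree m = 1" if "m \<in> Poly_Mapping.keys p" for m
  proof -
    have "\<exists>i\<in>{1..r}. m = Poly_Mapping.single i 1"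
    proof (rule ccontr)
      assume "\<not> ?thesis"
      then have "Poly_Mapping.lookup p m = 0"
        unfolding a(2) lookup_sum_linear_monomials by (intro sum.neutral) auto
      then show False using that by (simp add: in_keys_iff)
    qed
    then show ?thesis by (auto simp: monomial_degree_def)
  qed
  ultimately show "p \<in> forms R r 1" unfolding forms_def by blast
qed

theorem corollary1p3:
  fixes K \<O> :: "'a::field_char_0 set" and r :: nat
  assumes "number_field K"
    and "order_in K \<O>"
    and "r \<ge> 1"
  shows "g_invariant \<O> r \<noteq> \<infinity>"
proof -
  have sub: "unital_subring \<O>" and ring: "\<O> \<subseteq> ring_of_integers K"
    using assms(2) unfolding order_in_def by blast+
  obtain B0 where "finite B0" "rat_space.span B0 = K"
    using assms(1) unfolding number_field_def by blast
  then have "\<exists>S\<subseteq>\<O>. finite S \<and> (\<forall>x\<in>\<O>. \<exists>c. x = (\<Sum>s\<in>S. of_int (c s) * s))"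
    using ring by (intro integral_subring_finitely_generated[OF sub, of B0])
      (auto simp: ring_of_integers_def)
  then obtain S where S: "S \<subseteq> \<O>" "finite S" "\<And>x. x \<in> \<O> \<Longrightarrow> \<exists>c. x = (\<Sum>s\<in>S. of_int (c s) * s)"
    by (elim exE conjE) simp
  \<comment> \<open>The products of a variable with a generator of \<open>\<O>\<close> generate the
    additive group of linear forms over \<open>\<O>\<close>.\<close>
  define I where "I = {1..r} \<times> S"
  define \<theta> where "\<theta> = (\<lambda>(i, s). linear_monomial i s :: 'a mpolynomial)"
  have eq: "(\<Sum>t\<in>I. of_int (c t) * \<theta> t) = (\<Sum>i=1..r. linear_monomial i (\<Sum>s\<in>S. of_int (c (i, s)) * s))" for c
    unfolding I_def \<theta>_def linear_monomial_sum[symmetric] linear_monomial_scale[symmetric] sum.cartesian_product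
    by (intro sum.cong refl) auto
  have gen: "\<exists>c. p = (\<Sum>t\<in>I. of_int (c t) * \<theta> t)" if p: "p \<in> forms \<O> r 1" for p
  proof -
    obtain a where a: "\<forall>i\<in>{1..r}. a i \<in> \<O>" "p = (\<Sum>i=1..r. linear_monomial i (a i))"
      using p unfolding linear_forms_eq[OF sub] by (elim exE conjE) (rule that)
    have "\<forall>i\<in>{1..r}. \<exists>c. a i = (\<Sum>s\<in>S. of_int (c s) * s)" using a(1) S(3) by simp
    then obtain c where "\<forall>i\<in>{1..r}. a i = (\<Sum>s\<in>S. of_int (c i s) * s)"
      by (rule bchoice[THEN exE])
    then have "p = (\<Sum>t\<in>I. of_int ((\<lambda>(i, s). c i s) t) * \<theta> t)"
      unfolding eq a(2) by (intro sum.cong refl) simp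
    then show ?thesis by blast
  qed
  \<comment> \<open>The converse of \<open>gen\<close>: the new squares produced by
    \<open>bounded_squares_span\<close> are again squares of forms over \<open>\<O>\<close>.\<close>
  have mem: "(\<Sum>t\<in>I. of_int (c t) * \<theta> t) \<in> forms \<O> r 1" for c
    unfolding eq linear_forms_eq[OF sub] using S(1) sub
    by (intro exI[of _ "\<lambda>i. \<Sum>s\<in>S. of_int (c (i, s)) * s"] conjI ballI refl unital_subring_sum
        unital_subring_mult unital_subring_of_int) auto
  have "finite I" using S(2) by (simp add: I_def)
  then obtain G where G: "\<And>(N::nat) c. \<exists>c'. (\<Sum>k<N. (\<Sum>t\<in>I. of_int (c k t) * \<theta> t)\<^sup>2) =
    (\<Sum>k<G::nat. (\<Sum>t\<in>I. of_int (c' k t) * \<theta> t)\<^sup>2)"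
    using bounded_squares_span[of I \<theta>] by blast
  have "sum_of_squares \<O> r G q" if "q \<in> Sigma_forms \<O> r" for q
  proof -
    obtain N where "sum_of_squares \<O> r N q"
      using \<open>q \<in> Sigma_forms \<O> r\<close> unfolding Sigma_forms_def by blast
    then obtain l where "(\<forall>k<N. l k \<in> forms \<O> r 1) \<and> q = (\<Sum>k<N. (l k)\<^sup>2)"
      unfolding sum_of_squares_def by (rule exE)
    then have l: "\<forall>k<N. l k \<in> forms \<O> r 1" "q = (\<Sum>k<N. (l k)\<^sup>2)" by simp_all
    have "\<forall>k\<in>{..<N}. \<exists>c. l k = (\<Sum>t\<in>I. of_int (c t) * \<theta> t)" using gen l(1) by simp
    then obtain c where "\<forall>k\<in>{..<N}. l k = (\<Sum>t\<in>I. of_int (c k t) * \<theta> t)"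
      by (rule bchoice[THEN exE])
    then have "q = (\<Sum>k<N. (\<Sum>t\<in>I. of_int (c k t) * \<theta> t)\<^sup>2)" unfolding l(2) by simp
    moreover obtain c' where "(\<Sum>k<N. (\<Sum>t\<in>I. of_int (c k t) * \<theta> t)\<^sup>2) =
        (\<Sum>k<G. (\<Sum>t\<in>I. of_int (c' k t) * \<theta> t)\<^sup>2)"
      using G[where N = N and c = c] by (elim exE)
    ultimately show ?thesis unfolding sum_of_squares_def
      by (intro exI[of _ "\<lambda>k. \<Sum>t\<in>I. of_int (c' k t) * \<theta> t"] conjI allI impI mem) simp
  qed
  then have "g_invariant \<O> r \<le> enat G"
    unfolding g_invariant_def by (intro Inf_lower) blast
  then show ?thesis by (cases "g_invariant \<O> r") simp_all
qed

end
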